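(* Let $(X,d)$ be a complete separable metric space in which closed balls are compact, let $\mu$ be a Borel probability measure on $X$, let $C>0$, and let $\alpha:\mathbb{R}^+\to\mathbb{R}^+$ be an increasing convex function of class $\mathcal{C}^1$ with $\alpha(0)=0$. Suppose that $\alpha$ satisfies the $\Delta_2$-condition: there is a constant $K>0$ with $\alpha(2x)\le K\alpha(x)$ for all $x\ge0$. Then the exponents $r_\alpha\le p_\alpha$ defined by $$r_\alpha=\inf_{x>0}\frac{x\alpha'(x)}{\alpha(x)}\ \geq 1\qquad\text{and}\qquad 1<p_\alpha=\sup_{x>0}\frac{x\alpha'(x)}{\alpha(x)}$$ are both finite. Moreover, the measure $\mu$ satisfies ${\bf LSI}_\alpha^-(C)$ if and only if for all $t>0$, all $t_o\le C(p_\alpha-1)$ and all bounded continuous functions $f:X\to\mathbb{R}$, $$\left\|e^{Q_tf}\right\|_{k(t)}\le\left\|e^f\right\|_{k(0)},$$ where, if $r_\alpha>1$, $$k(t)=\left(1+\frac{C^{-1}(t-t_o)}{p_\alpha-1}\right)^{p_\alpha-1}\mathbf{1}_{t\le t_o}+\left(1+\frac{C^{-1}(t-t_o)}{r_\alpha-1}\right)^{r_\alpha-1}\mathbf{1}_{t>t_o},$$ and, if $r_\alpha=1$, $$k(t)=\min\left(1;\ \left(1+\frac{C^{-1}(t-t_o)}{p_\alpha-1}\right)^{p_\alpha-1}\right).$$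
   Context: For bounded $f:X\to\mathbb{R}$ and $t>0$, $Q_tf(x)=\inf_{y\in X}\{f(y)+t\,\alpha(d(x,y)/t)\}$. Norms: $\|g\|_k=\left(\int|g|^k\,d\mu\right)^{1/k}$ for $k\ne0$ and $\|g\|_0=\exp\left(\int\log g\,d\mu\right)$. Entropy: $\operatorname{Ent}_\mu(g)=\int g\log\left(\frac{g}{\int g\,d\mu}\right)d\mu$ for $g>0$. Let $\alpha^*(u)=\sup_{h\ge0}\{hu-\alpha(h)\}$, $u\ge0$, and $|\nabla^-f|(x)=\limsup_{y\to x}\frac{[f(y)-f(x)]_-}{d(x,y)}$ (negative part; $0$ if $x$ is isolated). For $r>0$, $\mathrm{Lip}(f,r)=\sup\left\{\frac{|f(y)-f(x)|}{d(x,y)}:\ x\neq y,\ d(x,y)\le r\right\}$ and $\mathrm{Lip}(f)=\sup_{r>0}\mathrm{Lip}(f,r)$. $\mathcal{F}_\alpha$ is the set of bounded functions $f:X\to\mathbb{R}$ such that $\mathrm{Lip}(f,r)<\infty$ for some $r>0$ and $\mathrm{Lip}(f)\le\lim_{h\to\infty}\alpha(h)/h$ (the last condition is empty if this limit is $+\infty$). The measure $\mu$ satisfies ${\bf LSI}_\alpha^-(C)$ if $$\operatorname{Ent}_\mu(e^f)\le C\int\alpha^*(|\nabla^-f|)\,e^f\,d\mu\qquad\forall f\in\mathcal{F}_\alpha.$$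
   Formalization: Linear α(x)=cx is excluded from the claim 1<p_α and from the equivalence: it meets all hypotheses but has p_α=1, so the claim fails and k(t) divides by zero; "increasing" is read as strictly increasing, which only excludes α=0. *)

theory Defs
  imports "HOL-Probability.Probability"
begin

text \<open>
  Cost functions live on the half-line: only the values of \<open>\<alpha>\<close> and of its derivative on
  \<open>{0..}\<close> are used below.  Nonnegative quantities that may be infinite (slopes, Lipschitz
  constants, the conjugate) take values in \<^typ>\<open>ennreal\<close>; there an empty supremum is
  \<open>0\<close>.
\<close>

definition hopf_lax ::
    "(real \<Rightarrow> real) \<Rightarrow> real \<Rightarrow> ('a::metric_space \<Rightarrow> real) \<Rightarrow> 'a \<Rightarrow> real" where
  "hopf_lax \<alpha> t f x = (INF y. f y + t * \<alpha> (dist x y / t))"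

definition Lk_norm :: "'a measure \<Rightarrow> real \<Rightarrow> ('a \<Rightarrow> real) \<Rightarrow> real" where
  "Lk_norm \<mu> k g =
     (if k = 0 then exp (\<integral>x. ln (g x) \<partial>\<mu>)
      else (\<integral>x. \<bar>g x\<bar> powr k \<partial>\<mu>) powr (1 / k))"

definition Ent :: "'a measure \<Rightarrow> ('a \<Rightarrow> real) \<Rightarrow> real" where
  "Ent \<mu> g = (\<integral>x. g x * ln (g x / (\<integral>z. g z \<partial>\<mu>)) \<partial>\<mu>)"

text \<open>
  The subtraction on \<^typ>\<open>ennreal\<close> truncates negative values to \<open>0\<close>.  This does not change
  the supremum when \<open>\<alpha> 0 = 0\<close>, since \<open>h = 0\<close> already contributes \<open>0\<close>.
\<close>

definition conjugate :: "(real \<Rightarrow> real) \<Rightarrow> ennreal \<Rightarrow> ennreal" where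
  "conjugate \<alpha> u = (SUP h\<in>{0..}. ennreal h * u - ennreal (\<alpha> h))"

text \<open>
  If \<open>x\<close> is isolated, the filter \<open>at x\<close> is trivial and the limit superior is \<open>0\<close>.
\<close>

definition descending_slope :: "('a::metric_space \<Rightarrow> real) \<Rightarrow> 'a \<Rightarrow> ennreal" where
  "descending_slope f x = Limsup (at x) (\<lambda>y. ennreal (max 0 (- (f y - f x)) / dist x y))"

definition Lip_upto :: "('a::metric_space \<Rightarrow> real) \<Rightarrow> real \<Rightarrow> ennreal" where
  "Lip_upto f r =
     (SUP (x, y) \<in> {(x, y). x \<noteq> y \<and> dist x y \<le> r}. ennreal (\<bar>f y - f x\<bar> / dist x y))"

definition Lip :: "('a::metric_space \<Rightarrow> real) \<Rightarrow> ennreal" where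
  "Lip f = (SUP r\<in>{0<..}. Lip_upto f r)"

text \<open>
  For convex \<open>\<alpha>\<close> with \<open>\<alpha> 0 = 0\<close> the quotient \<open>\<alpha> h / h\<close> is nondecreasing, so the limit below
  exists in \<^typ>\<open>ennreal\<close>; if it is \<open>\<infinity>\<close> the last condition is void.
\<close>

definition F_class :: "(real \<Rightarrow> real) \<Rightarrow> ('a::metric_space \<Rightarrow> real) set" where
  "F_class \<alpha> =
     {f. bounded (range f) \<and> (\<exists>r>0. Lip_upto f r < \<infinity>) \<and>
         Lip f \<le> Lim at_top (\<lambda>h. ennreal (\<alpha> h / h))}"

text \<open>
  The right-hand side may be infinite.  Embedding the entropy into \<^typ>\<open>ennreal\<close> is harmless:
  the other side is nonnegative, so a truncated negative value would satisfy the inequality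
  anyway.
\<close>

definition LSI_minus :: "(real \<Rightarrow> real) \<Rightarrow> real \<Rightarrow> 'a::metric_space measure \<Rightarrow> bool" where
  "LSI_minus \<alpha> C \<mu> \<longleftrightarrow>
     (\<forall>f\<in>F_class \<alpha>.
        ennreal (Ent \<mu> (\<lambda>x. exp (f x)))
          \<le> ennreal C * (\<integral>\<^sup>+x. conjugate \<alpha> (descending_slope f x) * ennreal (exp (f x)) \<partial>\<mu>))"

definition lower_exponent :: "(real \<Rightarrow> real) \<Rightarrow> (real \<Rightarrow> real) \<Rightarrow> ereal" where
  "lower_exponent \<alpha> \<alpha>' = (INF x\<in>{0<..}. ereal (x * \<alpha>' x / \<alpha> x))"

definition upper_exponent :: "(real \<Rightarrow> real) \<Rightarrow> (real \<Rightarrow> real) \<Rightarrow> ereal" where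
  "upper_exponent \<alpha> \<alpha>' = (SUP x\<in>{0<..}. ereal (x * \<alpha>' x / \<alpha> x))"

definition k_exponent :: "real \<Rightarrow> real \<Rightarrow> real \<Rightarrow> real \<Rightarrow> real \<Rightarrow> real" where
  "k_exponent C r p t\<^sub>0 t =
     (if r > 1 then
        (1 + inverse C * (t - t\<^sub>0) / (p - 1)) powr (p - 1) * of_bool (t \<le> t\<^sub>0)
        + (1 + inverse C * (t - t\<^sub>0) / (r - 1)) powr (r - 1) * of_bool (t > t\<^sub>0)
      else min 1 ((1 + inverse C * (t - t\<^sub>0) / (p - 1)) powr (p - 1)))"

end

theory Submission
  imports Defs
begin

text \<open>
  For \<open>f\<close> bounded and continuous, minimizers in the definition of \<open>Q\<^sub>t f\<close> exist because balls
  are compact.  If \<open>y\<close> is a farthest minimizer for \<open>(t, x)\<close> and \<open>h = d(x,y)/t\<close>, then the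
  descending slope of \<open>Q\<^sub>t f\<close> at \<open>x\<close> is at most \<open>\<alpha>' h\<close>, while \<open>t \<mapsto> Q\<^sub>t f(x)\<close> decreases at
  rate at least \<open>\<beta>(h) = h \<alpha>'(h) - \<alpha>(h) = \<alpha>\<^sup>*(\<alpha>'(h))\<close>.  By Fatou's lemma the log-Sobolev
  inequality applied to \<open>k(t) Q\<^sub>t f\<close>, combined with
  \<open>\<alpha>\<^sup>*(k u) \<le> k\<^bsup>P/(P-1)\<^esup> \<alpha>\<^sup>*(u)\<close> (\<open>P = p\<close> for \<open>k \<le> 1\<close>, \<open>P = r\<close> for \<open>k \<ge> 1\<close>), shows that the
  upper right Dini derivative of the logarithm of the \<open>k(t)\<close>-norm of \<open>exp (Q\<^sub>t f)\<close> is
  nonpositive; \<open>k\<close> solves exactly the differential equation which makes the two terms cancel.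
  At time \<open>0\<close> the bound \<open>Q\<^sub>t f \<le> f\<close> suffices.  Conversely, the choice \<open>t = t\<^sub>0 = \<epsilon>\<close> gives
  \<open>k(t) = 1\<close> and \<open>k(0) = 1 - \<epsilon>/C + o(\<epsilon>)\<close>, and letting \<open>\<epsilon> \<rightarrow> 0\<close> yields the log-Sobolev
  inequality.
\<close>

subsection \<open>Convex cost functions\<close>

text \<open>Neither the flow nor its norms are ever differentiated: the flow need not be
  differentiable in time. One minimizer supplies both the upper bound for the slope and the lower
  bound for the loss in time; it is a farthest one because minimizers for points near
  \<open>x\<close> may accumulate at any minimizer for \<open>x\<close>. Integrands are expanded to
  second order with errors uniform on the space. The scaling bound for the conjugate depends on the
  side of 1 on which \<open>k\<close> lies; hence the two branches of \<open>k\<close>, glued at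
  \<open>t\<^sub>0\<close>, where \<open>k = 1\<close>. For \<open>r = 1\<close> no scaling bound
  serves factors above 1, so \<open>k\<close> stays at 1. In the converse the obstacle is a function
  whose Lipschitz constant equals the limit of \<open>\<alpha> h / h\<close>: minimizers for a short
  time \<epsilon> need not lie within a distance of order \<epsilon>. The slope is never shown to be
  measurable. It enters only through monotonicity of the nonnegative integral, while Fatou's lemma
  and its reverse act on the measurable difference quotients.\<close>

text \<open>A supremum argument with slack slope \<epsilon>: \<open>left\<close> puts the supremum
  of the good times into the set, \<open>right\<close> moves past it. In place of continuity,
  \<open>left\<close> only excludes an upward jump on arrival from the left, which is what bounding
  a later time by an earlier one provides.\<close>

lemma right_dini_nonincreasing:
  fixes H :: "real \<Rightarrow> real"
  assumes "a \<le> b"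
    and right: "\<And>\<tau> \<epsilon>. a \<le> \<tau> \<Longrightarrow> \<tau> < b \<Longrightarrow> \<epsilon> > 0 \<Longrightarrow>
          eventually (\<lambda>s. H (\<tau> + s) \<le> H \<tau> + \<epsilon> * s) (at_right 0)"
    and left: "\<And>\<tau> e. a < \<tau> \<Longrightarrow> \<tau> \<le> b \<Longrightarrow> e > 0 \<Longrightarrow>
          eventually (\<lambda>\<sigma>. H \<tau> \<le> H \<sigma> + e) (at_left \<tau>)"
  shows "H b \<le> H a"
proof (rule field_le_epsilon)
  fix e :: real assume e: "e > 0"
  \<comment> \<open>The summand 1 covers \<open>a = b\<close> and still keeps the total slack
    \<open>\<epsilon> * (b - a)\<close> below \<open>e\<close>.\<close>
  define \<epsilon> where "\<epsilon> = e / (b - a + 1)"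
  have \<epsilon>: "\<epsilon> > 0" using e \<open>a \<le> b\<close> by (simp add: \<epsilon>_def)
  define S where "S = {\<tau>. a \<le> \<tau> \<and> \<tau> \<le> b \<and> H \<tau> \<le> H a + \<epsilon> * (\<tau> - a)}"
  have aS: "a \<in> S" using \<open>a \<le> b\<close> by (simp add: S_def)
  have bdd: "bdd_above S" by (rule bdd_aboveI[of _ b]) (simp add: S_def)
  define m where "m = Sup S"
  have am: "a \<le> m" unfolding m_def by (rule cSup_upper[OF aS bdd])
  have mb: "m \<le> b" unfolding m_def
    by (rule cSup_least) (use aS in \<open>auto simp: S_def\<close>)
  have mS: "m \<in> S"
  proof (cases "m = a")
    case True then show ?thesis using aS by simp
  next
    case False
    then have lt: "a < m" using am by simp
    have "H m \<le> H a + \<epsilon> * (m - a)"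
    proof (rule field_le_epsilon)
      fix e' :: real assume "e' > 0"
      then have "eventually (\<lambda>\<sigma>. H m \<le> H \<sigma> + e') (at_left m)"
        using left lt mb by blast
      then obtain d where d: "d < m" "\<And>\<sigma>. d < \<sigma> \<Longrightarrow> \<sigma> < m \<Longrightarrow> H m \<le> H \<sigma> + e'"
        by (auto simp: eventually_at_left[OF lt])
      have "d < Sup S" using d m_def by simp
      then obtain \<sigma> where \<sigma>: "\<sigma> \<in> S" "d < \<sigma>"
        using less_cSup_iff[of S d] aS bdd by blast
      have "\<sigma> \<le> m" unfolding m_def by (rule cSup_upper[OF \<sigma>(1) bdd])
      then have "H m \<le> H \<sigma> + e'"
        using d(2)[OF \<sigma>(2)] \<open>e' > 0\<close> by (cases "\<sigma> = m") auto
      also have "H \<sigma> \<le> H a + \<epsilon> * (\<sigma> - a)" using \<sigma>(1) by (simp add: S_def)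
      also have "\<dots> \<le> H a + \<epsilon> * (m - a)" using \<open>\<sigma> \<le> m\<close> \<epsilon> by simp
      finally show "H m \<le> H a + \<epsilon> * (m - a) + e'" by simp
    qed
    then show ?thesis using am mb by (simp add: S_def)
  qed
  have "m = b"
  proof (rule ccontr)
    assume "m \<noteq> b"
    then have "m < b" using mb by simp
    then have "eventually (\<lambda>s. H (m + s) \<le> H m + \<epsilon> * s) (at_right 0)"
      using right am \<epsilon> by blast
    then obtain d where d: "0 < d" "\<And>s. 0 < s \<Longrightarrow> s < d \<Longrightarrow> H (m + s) \<le> H m + \<epsilon> * s"
      by (auto simp: eventually_at_right[OF zero_less_one])
    define s where "s = min (d / 2) (b - m)"
    have s: "0 < s" "s < d" "m + s \<le> b" using d(1) \<open>m < b\<close> by (auto simp: s_def)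
    have "H (m + s) \<le> H a + \<epsilon> * (m + s - a)"
      using d(2)[OF s(1,2)] mS by (simp add: S_def algebra_simps)
    then have "m + s \<in> S" using s am by (simp add: S_def)
    then have "m + s \<le> m" unfolding m_def by (rule cSup_upper[OF _ bdd])
    then show False using s by simp
  qed
  then have "H b \<le> H a + \<epsilon> * (b - a)" using mS by (simp add: S_def)
  also have "\<epsilon> * (b - a) \<le> e" using e \<open>a \<le> b\<close> by (simp add: \<epsilon>_def field_simps)
  finally show "H b \<le> H a + e" by simp
qed

text \<open>For negative \<open>x\<close> the bound comes from
  \<open>exp x \<le> 1 / (1 - x)\<close> and
  \<open>(1 + x + x\<^sup>2) * (1 - x) = 1 - x ^ 3 \<ge> 1\<close>. It stands in for differentiation
  under the integral: an exponent of order \<open>s\<close> leaves an error of order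
  \<open>s\<^sup>2\<close>, uniformly on the space.\<close>

lemma exp_le_one_plus_square:
  fixes x :: real
  assumes "\<bar>x\<bar> \<le> 1"
  shows "exp x \<le> 1 + x + x\<^sup>2"
proof (cases "x \<ge> 0")
  case True then show ?thesis using exp_bound[of x] assms by simp
next
  case False
  have "exp (- (-x)) = inverse (exp (-x))" by (rule exp_minus)
  also have "\<dots> \<le> inverse (1 - x)"
    using exp_ge_add_one_self[of "-x"] False by (intro le_imp_inverse_le) auto
  also have "\<dots> \<le> 1 + x + x\<^sup>2"
  proof -
    have "1 \<le> (1 + x + x\<^sup>2) * (1 - x)"
    proof -
      have "(1 + x + x\<^sup>2) * (1 - x) = 1 - x^3" by (simp add: algebra_simps power2_eq_square power3_eq_cube)
      moreover have "x ^ 3 \<le> 0" using False by (simp add: power_le_zero_eq)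
      ultimately show ?thesis by simp
    qed
    then show ?thesis using False by (simp add: field_simps)
  qed
  finally show ?thesis by simp
qed

locale convex_cost =
  fixes \<alpha> \<alpha>' :: "real \<Rightarrow> real"
  assumes nonneg: "\<And>x. x \<ge> 0 \<Longrightarrow> \<alpha> x \<ge> 0"
    and incr: "strict_mono_on {0..} \<alpha>"
    and conv: "convex_on {0..} \<alpha>"
    and deriv: "\<And>x. x \<ge> 0 \<Longrightarrow> (\<alpha> has_real_derivative \<alpha>' x) (at x within {0..})"
    and C1: "continuous_on {0..} \<alpha>'"
    and zero: "\<alpha> 0 = 0"
begin

lemma continuous_cost: "continuous_on {0..} \<alpha>"
  by (metis DERIV_continuous_on atLeast_iff deriv)

lemma pos: "x > 0 \<Longrightarrow> \<alpha> x > 0"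
  using incr zero by (metis atLeast_iff less_eq_real_def strict_mono_onD order_refl)

text \<open>Convexity gives the bound at interior base points; the base point 0 is reached by
  letting \<open>c\<close> tend to 0 from the right, using continuity of \<open>\<alpha>\<close> and
  \<open>\<alpha>'\<close>.\<close>

lemma tangent_le:
  assumes "x \<ge> 0" "y \<ge> 0"
  shows "\<alpha> x + \<alpha>' x * (y - x) \<le> \<alpha> y"
proof -
  have *: "\<alpha> c + \<alpha>' c * (y - c) \<le> \<alpha> y" if "c > 0" for c
  proof -
    have "\<alpha> y - \<alpha> c \<ge> \<alpha>' c * (y - c)"
    proof (rule convex_on_imp_above_tangent[OF conv])
      show "c \<in> interior {0..}" using that by simp
    qed (use that assms deriv in auto)
    then show ?thesis by simp
  qed
  show ?thesis
  proof (cases "x = 0")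
    case False then show ?thesis using * assms by simp
  next
    case True
    have "((\<lambda>c. \<alpha> c + \<alpha>' c * (y - c)) \<longlongrightarrow> \<alpha> 0 + \<alpha>' 0 * (y - 0)) (at 0 within {0..})"
      using continuous_cost C1 by (intro tendsto_intros) (auto simp: continuous_on_def)
    then have "((\<lambda>c. \<alpha> c + \<alpha>' c * (y - c)) \<longlongrightarrow> \<alpha> 0 + \<alpha>' 0 * (y - 0)) (at_right 0)"
      by (rule tendsto_within_subset) auto
    moreover have "eventually (\<lambda>c. \<alpha> c + \<alpha>' c * (y - c) \<le> \<alpha> y) (at_right 0)"
      using * by (auto simp: eventually_at_filter)
    ultimately show ?thesis using True
      by (metis tendsto_upperbound trivial_limit_at_right_real)
  qed
qed

lemma deriv_mono:
  assumes "0 \<le> x" "x \<le> y"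
  shows "\<alpha>' x \<le> \<alpha>' y"
proof (cases "x = y")
  case False
  have "\<alpha> x + \<alpha>' x * (y - x) \<le> \<alpha> y" "\<alpha> y + \<alpha>' y * (x - y) \<le> \<alpha> x"
    using assms by (auto intro: tangent_le)
  then have "\<alpha>' x * (y - x) \<le> \<alpha>' y * (y - x)" by (simp add: algebra_simps)
  then show ?thesis using False assms by simp
qed simp

lemma deriv_nonneg: "x \<ge> 0 \<Longrightarrow> \<alpha>' x \<ge> 0"
proof -
  have "0 \<le> \<alpha>' 0"
  proof (rule ccontr)
    assume neg: "\<not> 0 \<le> \<alpha>' 0"
    have "(\<alpha>' \<longlongrightarrow> \<alpha>' 0) (at 0 within {0..})" using C1 by (auto simp: continuous_on_def)
    then have "(\<alpha>' \<longlongrightarrow> \<alpha>' 0) (at_right 0)"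
      by (rule tendsto_within_subset) auto
    then have "eventually (\<lambda>x. \<alpha>' x < 0) (at_right 0)"
      using neg by (simp add: order_tendstoD)
    then obtain b where "b > 0" "\<And>y. 0 < y \<Longrightarrow> y < b \<Longrightarrow> \<alpha>' y < 0"
      by (auto simp: eventually_at_right[OF zero_less_one])
    then have "\<alpha>' (b/2) < 0" "b / 2 > 0" by auto
    moreover have "\<alpha> (b/2) + \<alpha>' (b/2) * (0 - b/2) \<le> \<alpha> 0" using \<open>b > 0\<close> by (intro tangent_le) auto
    moreover have "\<alpha> (b/2) > 0" using \<open>b > 0\<close> by (intro pos) auto
    moreover have "\<alpha>' (b/2) * (0 - b/2) > 0" 
      using calculation by (intro mult_neg_neg) auto
    ultimately show False using zero by linarith
  qed
  then show "x \<ge> 0 \<Longrightarrow> \<alpha>' x \<ge> 0" using deriv_mono[of 0 x] by simp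
qed

text \<open>Besides being the conjugate at the slope \<open>\<alpha>' h\<close>, this is minus the
  time derivative of \<open>t * \<alpha> (d / t)\<close> at \<open>h = d / t\<close>. Through this
  double role the loss in time pays for the slope in space.\<close>

definition \<beta> :: "real \<Rightarrow> real" where "\<beta> h = h * \<alpha>' h - \<alpha> h"

lemma \<beta>_nonneg: "h \<ge> 0 \<Longrightarrow> \<beta> h \<ge> 0"
  using tangent_le[of h 0] zero by (simp add: \<beta>_def algebra_simps)

lemma \<beta>_mono:
  assumes "0 \<le> h" "h \<le> g"
  shows "\<beta> h \<le> \<beta> g"
proof -
  have "\<alpha> g + \<alpha>' g * (h - g) \<le> \<alpha> h" using assms by (intro tangent_le) auto
  moreover have "h * \<alpha>' h \<le> h * \<alpha>' g" using assms deriv_mono by (intro mult_left_mono) auto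
  ultimately show ?thesis by (simp add: \<beta>_def algebra_simps)
qed

lemma continuous_\<beta>: "continuous_on {0..} \<beta>"
  unfolding \<beta>_def by (intro continuous_intros C1 continuous_cost)

lemma ratio_mono:
  assumes "0 < h" "h \<le> g"
  shows "\<alpha> h / h \<le> \<alpha> g / g"
proof -
  have "\<alpha> h + \<alpha>' h * (0 - h) \<le> \<alpha> 0" using assms by (intro tangent_le) auto
  then have 1: "\<alpha> h / h \<le> \<alpha>' h" using assms zero by (simp add: field_simps)
  have "\<alpha> h + \<alpha>' h * (g - h) \<le> \<alpha> g" using assms by (intro tangent_le) auto
  moreover have "\<alpha> h / h * (g - h) \<le> \<alpha>' h * (g - h)" using 1 assms by (intro mult_right_mono) auto
  moreover have "\<alpha> h + \<alpha> h / h * (g - h) = \<alpha> h / h * g" using assms by (simp add: field_simps)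
  ultimately have "\<alpha> h / h * g \<le> \<alpha> g" by linarith
  then show ?thesis using assms by (simp add: pos_le_divide_eq)
qed

lemma Lim_ratio_tendsto:
  "((\<lambda>h. ennreal (\<alpha> h / h)) \<longlongrightarrow> (SUP h\<in>{0<..}. ennreal (\<alpha> h / h))) at_top"
proof (rule increasing_tendsto)
  show "eventually (\<lambda>h. ennreal (\<alpha> h / h) \<le> (SUP h\<in>{0<..}. ennreal (\<alpha> h / h))) at_top"
    using eventually_gt_at_top[of "0::real"] by eventually_elim (auto intro: SUP_upper)
  fix x assume "x < (SUP h\<in>{0<..}. ennreal (\<alpha> h / h))"
  then obtain h where h: "h > 0" "x < ennreal (\<alpha> h / h)" by (auto simp: less_SUP_iff)
  show "eventually (\<lambda>h. x < ennreal (\<alpha> h / h)) at_top"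
    using eventually_ge_at_top[of h]
  proof eventually_elim
    case (elim g)
    show ?case using h(2) ratio_mono[OF h(1) elim] by (meson ennreal_leI less_le_trans)
  qed
qed

lemma Lim_ratio_eq: "Lim at_top (\<lambda>h. ennreal (\<alpha> h / h)) = (SUP h\<in>{0<..}. ennreal (\<alpha> h / h))"
  by (rule tendsto_Lim[OF _ Lim_ratio_tendsto]) simp

text \<open>Divide the tangent inequality at \<open>h\<close>, read off at a distant
  \<open>g\<close>, by \<open>g\<close>. Lipschitz quotients of the flow are bounded by values of
  \<open>\<alpha>'\<close>, which are thereby compared with the cap in
  \<open>F_class\<close>.\<close>

lemma deriv_le_Lim_ratio:
  assumes "h \<ge> 0"
  shows "ennreal (\<alpha>' h) \<le> Lim at_top (\<lambda>h. ennreal (\<alpha> h / h))"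
proof (rule tendsto_le)
  show "((\<lambda>h. ennreal (\<alpha> h / h)) \<longlongrightarrow> Lim at_top (\<lambda>h. ennreal (\<alpha> h / h))) at_top"
    using Lim_ratio_tendsto by (simp add: Lim_ratio_eq)
  have "((\<lambda>g. \<alpha>' h * (1 - h * inverse g)) \<longlongrightarrow> \<alpha>' h * (1 - h * 0)) at_top"
    by (intro tendsto_intros tendsto_inverse_0_at_top filterlim_ident)
  then show "((\<lambda>g. ennreal (\<alpha>' h * (1 - h * inverse g))) \<longlongrightarrow> ennreal (\<alpha>' h)) at_top"
    by (intro tendsto_ennrealI) simp
  show "eventually (\<lambda>g. ennreal (\<alpha>' h * (1 - h * inverse g)) \<le> ennreal (\<alpha> g / g)) at_top"
    using eventually_gt_at_top[of "0::real"]
  proof eventually_elim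
    case (elim g)
    have "\<alpha> h + \<alpha>' h * (g - h) \<le> \<alpha> g" using assms elim by (intro tangent_le) auto
    then have "\<alpha>' h * (g - h) \<le> \<alpha> g" using nonneg[OF assms] by linarith
    then have "\<alpha>' h * (g - h) / g \<le> \<alpha> g / g" using elim by (intro divide_right_mono) auto
    also have "\<alpha>' h * (g - h) / g = \<alpha>' h * (1 - h * inverse g)" using elim by (simp add: field_simps)
    finally show ?case by (rule ennreal_leI)
  qed
qed simp

text \<open>Since \<open>t * \<alpha> (d / t)\<close> is convex in \<open>t\<close> with derivative
  \<open>- \<beta> (d / t)\<close>, its loss over a time \<open>s\<close> lies between
  \<open>s\<close> times the values of \<beta> at the two ends. The lower estimate is the tangent at
  \<open>d / (t + s)\<close> multiplied by \<open>t\<close>; the upper one is the tangent at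
  \<open>d / t\<close> multiplied by \<open>t + s\<close>.\<close>

lemma perspective_decrease_ge:
  assumes "t > 0" "s \<ge> 0" "d \<ge> 0"
  shows "s * \<beta> (d / (t + s)) \<le> t * \<alpha> (d / t) - (t + s) * \<alpha> (d / (t + s))"
proof -
  define h where "h = d / (t + s)"
  have d: "d = h * (t + s)" using assms by (simp add: h_def)
  have "\<alpha> h + \<alpha>' h * (d / t - h) \<le> \<alpha> (d / t)" using assms by (intro tangent_le) (auto simp: h_def)
  then have "t * (\<alpha> h + \<alpha>' h * (d / t - h)) \<le> t * \<alpha> (d / t)" using assms by simp
  moreover have "t * (\<alpha> h + \<alpha>' h * (d / t - h)) = t * \<alpha> h + \<alpha>' h * (s * h)"
    using assms by (simp add: d field_simps)
  ultimately show ?thesis unfolding h_def[symmetric] by (simp add: \<beta>_def algebra_simps)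
qed

lemma perspective_decrease_le:
  assumes "t > 0" "s \<ge> 0" "d \<ge> 0"
  shows "t * \<alpha> (d / t) - (t + s) * \<alpha> (d / (t + s)) \<le> s * \<beta> (d / t)"
proof -
  define h where "h = d / t"
  have d: "d = h * t" using assms by (simp add: h_def)
  have "\<alpha> h + \<alpha>' h * (d / (t + s) - h) \<le> \<alpha> (d / (t + s))" using assms by (intro tangent_le) (auto simp: h_def)
  then have "(t + s) * (\<alpha> h + \<alpha>' h * (d / (t + s) - h)) \<le> (t + s) * \<alpha> (d / (t + s))" using assms by simp
  moreover have "(t + s) * (\<alpha> h + \<alpha>' h * (d / (t + s) - h)) = (t + s) * \<alpha> h - \<alpha>' h * (s * h)"
    using assms by (simp add: d field_simps)
  ultimately show ?thesis unfolding h_def[symmetric] by (simp add: \<beta>_def algebra_simps)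
qed

lemma perspective_antimono:
  assumes "0 < s" "s \<le> t" "d \<ge> 0"
  shows "t * \<alpha> (d / t) \<le> s * \<alpha> (d / s)"
proof -
  have "(t - s) * \<beta> (d / (s + (t - s))) \<le> s * \<alpha> (d / s) - (s + (t - s)) * \<alpha> (d / (s + (t - s)))"
    using assms by (intro perspective_decrease_ge) auto
  moreover have "(t - s) * \<beta> (d / (s + (t - s))) \<ge> 0"
    using assms by (intro mult_nonneg_nonneg \<beta>_nonneg) auto
  ultimately show ?thesis by simp
qed

lemma has_deriv_at: "x > 0 \<Longrightarrow> (\<alpha> has_real_derivative \<alpha>' x) (at x)"
  using deriv[of x] at_within_interior[of x "{0..}"] by simp

section \<open>Growth exponents and the scaling of the conjugate\<close>

lemma deriv_cost_over_powr:
  assumes "x > 0"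
  shows "((\<lambda>x. \<alpha> x * x powr (-P)) has_real_derivative (x * \<alpha>' x - P * \<alpha> x) * x powr (-P-1)) (at x)"
proof -
  have "((\<lambda>x. \<alpha> x * x powr (-P)) has_real_derivative
      \<alpha>' x * x powr (-P) + (- P * x powr (-P - 1)) * \<alpha> x) (at x)"
    using assms by (intro DERIV_mult has_deriv_at has_real_derivative_powr)
  also have "x powr (-P) = x * x powr (-P-1)"
    using assms by (simp add: powr_mult_base)
  finally show ?thesis by (simp add: algebra_simps)
qed

text \<open>Either growth bound makes \<open>\<alpha> x * x powr (-P)\<close> monotone:
  nonincreasing when paired with \<open>c \<le> 1\<close>, nondecreasing when paired with
  \<open>c \<ge> 1\<close>. In both cases passing from \<open>g\<close> to \<open>c * g\<close> does
  not lower it.\<close>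

lemma cost_scale_ge:
  assumes c: "c > 0" and g: "g \<ge> 0"
    and "(c \<le> 1 \<and> (\<forall>x>0. x * \<alpha>' x \<le> P * \<alpha> x)) \<or> (c \<ge> 1 \<and> (\<forall>x>0. P * \<alpha> x \<le> x * \<alpha>' x))"
  shows "c powr P * \<alpha> g \<le> \<alpha> (c * g)"
proof (cases "g = 0")
  case True then show ?thesis by (simp add: zero)
next
  case False
  then have g: "g > 0" using g by simp
  let ?\<phi> = "\<lambda>x. \<alpha> x * x powr (-P)"
  have "?\<phi> g \<le> ?\<phi> (c * g)"
    using assms(3)
  proof
    assume *: "c \<le> 1 \<and> (\<forall>x>0. x * \<alpha>' x \<le> P * \<alpha> x)"
    show ?thesis
    proof (rule DERIV_nonpos_imp_nonincreasing[where f = ?\<phi>])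
      show "c * g \<le> g" using * g by simp
      fix x assume "c * g \<le> x" "x \<le> g"
      moreover have "0 < c * g" using c g by simp
      ultimately have x: "x > 0" by linarith
      have "(x * \<alpha>' x - P * \<alpha> x) * x powr (-P-1) \<le> 0"
        using * x by (intro mult_nonpos_nonneg) auto
      then show "\<exists>y. DERIV ?\<phi> x :> y \<and> y \<le> 0"
        using deriv_cost_over_powr[OF x] by blast
    qed
  next
    assume *: "c \<ge> 1 \<and> (\<forall>x>0. P * \<alpha> x \<le> x * \<alpha>' x)"
    show ?thesis
    proof (rule DERIV_nonneg_imp_nondecreasing[where f = ?\<phi>])
      show "g \<le> c * g" using * g by simp
      fix x assume "g \<le> x" "x \<le> c * g"
      then have x: "x > 0" using g by linarith
      have "(x * \<alpha>' x - P * \<alpha> x) * x powr (-P-1) \<ge> 0"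
        using * x by (intro mult_nonneg_nonneg) auto
      then show "\<exists>y. (?\<phi> has_real_derivative y) (at x) \<and> y \<ge> 0"
        using deriv_cost_over_powr[OF x] by blast
    qed
  qed
  also have "\<dots> = \<alpha> (c * g) / (c powr P * g powr P)"
    using c g by (simp add: powr_mult powr_minus divide_simps)
  finally show ?thesis using c g by (simp add: powr_minus field_simps)
qed

text \<open>The bound \<open>\<alpha>\<^sup>*(\<kappa> u) \<le> \<kappa>\<^bsup>P/(P-1)\<^esup> \<alpha>\<^sup>*(u)\<close> at \<open>u = \<alpha>' h\<close>, where \<open>\<alpha>\<^sup>*(u) = \<beta> h\<close>.\<close>
lemma conjugate_scale_le:
  assumes \<kappa>: "\<kappa> > 0" and P: "P > 1" and g: "g \<ge> 0" and h: "h \<ge> 0"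
    and growth: "(\<kappa> \<le> 1 \<and> (\<forall>x>0. x * \<alpha>' x \<le> P * \<alpha> x)) \<or> (\<kappa> \<ge> 1 \<and> (\<forall>x>0. P * \<alpha> x \<le> x * \<alpha>' x))"
  shows "g * (\<kappa> * \<alpha>' h) - \<alpha> g \<le> \<kappa> powr (P / (P - 1)) * \<beta> h"
proof -
  \<comment> \<open>\<open>c\<close> solves \<open>c powr P = c * \<kappa>\<close>. With
    \<open>g = c * g'\<close>, the linear term and the lower bound for \<open>\<alpha> g\<close>
    share the factor \<open>c * \<kappa> = \<kappa> powr (P / (P - 1))\<close>, and the tangent
    inequality at \<open>h\<close> remains.\<close>
  define c where "c = \<kappa> powr (1 / (P - 1))"
  have c: "c > 0" using \<kappa> by (simp add: c_def)
  define g' where "g' = g / c"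
  have g': "g' \<ge> 0" "g = c * g'" using g c by (auto simp: g'_def)
  have "c \<le> 1" if "\<kappa> \<le> 1"
    using that \<kappa> P powr_mono2[of "1 / (P - 1)" \<kappa> 1] by (simp add: c_def)
  moreover have "c \<ge> 1" if "\<kappa> \<ge> 1"
    using that P by (simp add: c_def ge_one_powr_ge_zero)
  ultimately have "c powr P * \<alpha> g' \<le> \<alpha> g"
    unfolding g'(2) using growth c g' by (intro cost_scale_ge) auto
  moreover have cP: "c powr P = c * \<kappa>"
  proof -
    have "c powr P = \<kappa> powr (P / (P - 1))" using P by (simp add: c_def powr_powr)
    also have "P / (P - 1) = 1 / (P - 1) + 1" using P by (simp add: field_simps)
    also have "\<kappa> powr \<dots> = c * \<kappa>" using \<kappa> by (simp add: powr_add c_def)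
    finally show ?thesis .
  qed
  moreover have "\<kappa> powr (P / (P - 1)) = c * \<kappa>"
    using cP P by (simp add: c_def powr_powr)
  moreover have "c * \<kappa> * (g' * \<alpha>' h - \<alpha> g') \<le> c * \<kappa> * \<beta> h"
  proof (intro mult_left_mono)
    have "\<alpha> h + \<alpha>' h * (g' - h) \<le> \<alpha> g'" using h g' by (intro tangent_le)
    then show "g' * \<alpha>' h - \<alpha> g' \<le> \<beta> h" by (simp add: \<beta>_def algebra_simps)
  qed (use c \<kappa> in simp)
  ultimately show ?thesis unfolding g'(2) by (simp add: algebra_simps)
qed

lemma conjugate_le:
  assumes "u \<ge> 0" "\<And>g. g \<ge> 0 \<Longrightarrow> g * u - \<alpha> g \<le> b"
  shows "conjugate \<alpha> (ennreal u) \<le> ennreal b"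
  unfolding conjugate_def
proof (rule SUP_least)
  fix g :: real assume "g \<in> {0..}"
  then have g: "g \<ge> 0" by simp
  have "ennreal g * ennreal u - ennreal (\<alpha> g) = ennreal (g * u - \<alpha> g)"
    using g assms(1) nonneg[OF g] by (simp add: ennreal_minus flip: ennreal_mult)
  also have "\<dots> \<le> ennreal b" using assms g by (intro ennreal_leI) auto
  finally show "ennreal g * ennreal u - ennreal (\<alpha> g) \<le> ennreal b" .
qed

text \<open>A finite limit \<open>l\<close> bounds \<open>\<alpha>'\<close>, hence
  \<open>r * \<alpha> h \<le> h * l\<close>, and the limit would be at most
  \<open>l / r < l\<close>. So for \<open>r > 1\<close> the Lipschitz cap in \<open>F_class\<close>
  is void, which admits multiples of the flow by factors above 1.\<close>

lemma Lim_ratio_eq_top: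
  assumes "r > 1" "\<And>x. x > 0 \<Longrightarrow> r * \<alpha> x \<le> x * \<alpha>' x"
  shows "Lim at_top (\<lambda>h. ennreal (\<alpha> h / h)) = \<top>"
proof (rule ccontr)
  let ?L = "Lim at_top (\<lambda>h. ennreal (\<alpha> h / h))"
  assume "?L \<noteq> \<top>"
  then obtain l where l: "l \<ge> 0" "?L = ennreal l" by (cases ?L) auto
  have up: "\<alpha>' h \<le> l" if "h \<ge> 0" for h
    using deriv_le_Lim_ratio[OF that] l by simp
  have "l \<ge> \<alpha>' 1" using up by simp
  then have lpos: "l > 0" using tangent_le[of 1 0] pos[of 1] zero by simp
  have "ennreal (\<alpha> h / h) \<le> ennreal (l / r)" if "h > 0" for h
  proof (rule ennreal_leI)
    have "r * \<alpha> h \<le> h * \<alpha>' h" by (rule assms(2)[OF that])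
    also have "\<dots> \<le> h * l" using up[of h] that by (intro mult_left_mono) auto
    finally have "r * \<alpha> h \<le> h * l" .
    then show "\<alpha> h / h \<le> l / r" using assms(1) that by (simp add: field_simps)
  qed
  then have "?L \<le> ennreal (l / r)" unfolding Lim_ratio_eq by (intro SUP_least) auto
  then have "l \<le> l / r" using l assms by simp
  then show False using lpos assms by (simp add: field_simps)
qed

end

subsection \<open>The Hopf-Lax flow\<close>

locale hopf_lax_flow = convex_cost \<alpha> \<alpha>' for \<alpha> \<alpha>' +
  fixes f :: "'a::metric_space \<Rightarrow> real" and B :: real
  assumes proper: "\<And>(x::'a) \<rho>. compact (cball x \<rho>)"
    and cont: "continuous_on UNIV f"
    and bound: "\<And>x. \<bar>f x\<bar> \<le> B"
begin

abbreviation Q :: "real \<Rightarrow> 'a \<Rightarrow> real" where "Q t x \<equiv> hopf_lax \<alpha> t f x"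

text \<open>A radius containing all minimizers. Since \<open>f\<close> oscillates by at most
  \<open>2 * B\<close>, a minimizer costs no more than that, whereas a displacement
  \<open>d > t\<close> costs at least \<open>\<alpha> 1 * d\<close>; so \<open>R t\<close> dominates
  both \<open>t\<close> and \<open>2 * B / \<alpha> 1\<close>.\<close>

definition R :: "real \<Rightarrow> real" where "R t = t + (2 * B + 1) / \<alpha> 1"

definition minimizer :: "real \<Rightarrow> 'a \<Rightarrow> 'a \<Rightarrow> bool" where
  "minimizer t x y \<longleftrightarrow> Q t x = f y + t * \<alpha> (dist x y / t)"

lemma B_nonneg: "B \<ge> 0"
  using bound[of undefined] by linarith

lemma bdd_below_flow:
  assumes "t > 0"
  shows "bdd_below (range (\<lambda>y. f y + t * \<alpha> (dist x y / t)))"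
proof (rule bdd_belowI2)
  fix y
  have "t * \<alpha> (dist x y / t) \<ge> 0" using assms nonneg by simp
  then show "- B \<le> f y + t * \<alpha> (dist x y / t)" using bound[of y] by linarith
qed

lemma flow_le: "t > 0 \<Longrightarrow> Q t x \<le> f y + t * \<alpha> (dist x y / t)"
  unfolding hopf_lax_def by (intro cINF_lower bdd_below_flow) auto

lemma flow_le_self: "t > 0 \<Longrightarrow> Q t x \<le> f x"
  using flow_le[of t x x] by (simp add: zero)

lemma flow_bound: "t > 0 \<Longrightarrow> \<bar>Q t x\<bar> \<le> B"
proof -
  assume t: "t > 0"
  have "- B \<le> Q t x" unfolding hopf_lax_def
  proof (rule cINF_greatest)
    fix y
    have "t * \<alpha> (dist x y / t) \<ge> 0" using t nonneg by simp
    then show "- B \<le> f y + t * \<alpha> (dist x y / t)" using bound[of y] by linarith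
  qed simp
  then show ?thesis using flow_le_self[OF t, of x] bound[of x] by linarith
qed

lemma R_mono: "s \<le> t \<Longrightarrow> R s \<le> R t"
  by (simp add: R_def)

lemma R_ge: "t \<le> R t"
  using B_nonneg pos[of 1] by (simp add: R_def)

lemma dist_le_R:
  assumes t: "t > 0" and "t * \<alpha> (dist x y / t) \<le> 2 * B"
  shows "dist x y \<le> R t"
proof (rule ccontr)
  assume "\<not> ?thesis"
  then have d: "dist x y > R t" by simp
  then have "dist x y > t" using R_ge[of t] by linarith
  then have "\<alpha> 1 / 1 \<le> \<alpha> (dist x y / t) / (dist x y / t)" using t by (intro ratio_mono) auto
  then have "\<alpha> 1 * dist x y \<le> t * \<alpha> (dist x y / t)"
    using \<open>dist x y > t\<close> t less_trans[OF t \<open>dist x y > t\<close>]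
    by (simp add: pos_le_divide_eq mult.commute)
  then have "dist x y \<le> 2 * B / \<alpha> 1" using assms(2) pos[of 1] by (simp add: field_simps)
  also have "\<dots> < R t" using t pos[of 1] add_pos_pos[OF zero_less_one mult_pos_pos[OF t pos[of 1]]]
    by (simp add: R_def field_simps)
  finally show False using d by simp
qed

lemma minimizer_dist:
  assumes "t > 0" "minimizer t x y"
  shows "dist x y \<le> R t"
proof (rule dist_le_R[OF assms(1)])
  have "f y + t * \<alpha> (dist x y / t) \<le> f x"
    using assms flow_le_self[of t x] by (simp add: minimizer_def)
  then show "t * \<alpha> (dist x y / t) \<le> 2 * B" using bound[of x] bound[of y] by linarith
qed

lemma continuous_objective:
  assumes "t > 0"
  shows "continuous_on UNIV (\<lambda>y. f y + t * \<alpha> (dist x y / t))"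
proof -
  have "continuous_on UNIV (\<lambda>y. \<alpha> (dist x y / t))"
    by (rule continuous_on_compose2[OF continuous_cost]) (use assms in \<open>auto intro!: continuous_intros\<close>)
  then show ?thesis using cont by (intro continuous_intros)
qed

lemma minimizer_exists:
  assumes t: "t > 0"
  shows "\<exists>y. minimizer t x y"
proof -
  let ?F = "\<lambda>y. f y + t * \<alpha> (dist x y / t)"
  have "R t \<ge> 0" using R_ge[of t] t by linarith
  then have x: "x \<in> cball x (R t)" by simp
  obtain y where y: "y \<in> cball x (R t)" "\<And>z. z \<in> cball x (R t) \<Longrightarrow> ?F y \<le> ?F z"
    using continuous_attains_inf[OF proper, of x "R t" ?F] x
      continuous_on_subset[OF continuous_objective[OF t]] by blast
  have "?F y \<le> ?F z" for z
  proof (cases "z \<in> cball x (R t)")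
    case False
    then have "t * \<alpha> (dist x z / t) > 2 * B" using dist_le_R[OF t, of x z] by force
    then have "f x \<le> ?F z" using bound[of x] bound[of z] by linarith
    moreover have "?F y \<le> f x" using y(2)[OF x] by (simp add: zero)
    ultimately show ?thesis by linarith
  qed (use y in auto)
  then have "Q t x = ?F y"
    unfolding hopf_lax_def by (intro antisym cINF_lower2[OF bdd_below_flow[OF t]] cINF_greatest) auto
  then show ?thesis by (auto simp: minimizer_def)
qed

lemma flow_antimono:
  assumes "0 < s" "s \<le> t"
  shows "Q t x \<le> Q s x"
proof -
  obtain y where y: "minimizer s x y" using minimizer_exists assms by blast
  have "Q t x \<le> f y + t * \<alpha> (dist x y / t)" using assms by (intro flow_le) auto
  also have "\<dots> \<le> f y + s * \<alpha> (dist x y / s)" using assms by (intro add_left_mono perspective_antimono) auto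
  finally show ?thesis using y by (simp add: minimizer_def)
qed

text \<open>The minimizer of the later time is tested at time \<open>t\<close>. The bound is uniform
  in \<open>x\<close>, which makes the time quotients integrable and controls the second-order
  errors.\<close>

lemma flow_time_lipschitz:
  assumes t: "t > 0" and s: "0 \<le> s" "s \<le> 1"
  shows "Q t x - Q (t + s) x \<le> s * \<beta> (R (t + 1) / t)"
proof -
  obtain y where y: "minimizer (t + s) x y" using minimizer_exists[of "t + s" x] assms by auto
  have d: "dist x y \<le> R (t + 1)"
    using minimizer_dist[OF _ y] R_mono[of "t + s" "t + 1"] t s by force
  have "Q t x - Q (t + s) x \<le> t * \<alpha> (dist x y / t) - (t + s) * \<alpha> (dist x y / (t + s))"
    using flow_le[OF t, of x y] y by (simp add: minimizer_def)
  also have "\<dots> \<le> s * \<beta> (dist x y / t)" using assms by (intro perspective_decrease_le) auto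
  also have "\<dots> \<le> s * \<beta> (R (t + 1) / t)"
    using assms d by (intro mult_left_mono \<beta>_mono divide_right_mono) auto
  finally show ?thesis .
qed

lemma flow_time_decrease:
  assumes "t > 0" "s \<ge> 0" "minimizer t x y"
  shows "s * \<beta> (dist x y / (t + s)) \<le> Q t x - Q (t + s) x"
proof -
  have "s * \<beta> (dist x y / (t + s)) \<le> t * \<alpha> (dist x y / t) - (t + s) * \<alpha> (dist x y / (t + s))"
    using assms by (intro perspective_decrease_ge) auto
  moreover have "Q (t + s) x \<le> f y + (t + s) * \<alpha> (dist x y / (t + s))"
    using assms by (intro flow_le) auto
  ultimately show ?thesis using assms(3) by (simp add: minimizer_def)
qed

text \<open>The tangent is taken at \<open>dist x y / t\<close>, measured from \<open>x\<close> and
  not from \<open>z\<close>. As \<open>z\<close> tends to \<open>x\<close>, the constant involves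
  only distances from the fixed point \<open>x\<close>.\<close>

lemma flow_space_le:
  assumes t: "t > 0" and y: "minimizer t z y"
  shows "Q t x - Q t z \<le> \<alpha>' (dist x y / t) * dist x z"
proof -
  have "Q t x - Q t z \<le> t * \<alpha> (dist x y / t) - t * \<alpha> (dist z y / t)"
    using flow_le[OF t, of x y] y by (simp add: minimizer_def)
  also have "\<dots> \<le> \<alpha>' (dist x y / t) * (dist x y - dist z y)"
  proof -
    have "\<alpha> (dist x y / t) + \<alpha>' (dist x y / t) * (dist z y / t - dist x y / t) \<le> \<alpha> (dist z y / t)"
      using t by (intro tangent_le) auto
    then have "t * (\<alpha> (dist x y / t) + \<alpha>' (dist x y / t) * (dist z y / t - dist x y / t)) \<le> t * \<alpha> (dist z y / t)"
      using t by simp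
    then show ?thesis using t by (simp add: algebra_simps)
  qed
  also have "\<dots> \<le> \<alpha>' (dist x y / t) * dist x z"
    using t deriv_nonneg dist_triangle[of x y z] by (intro mult_left_mono) auto
  finally show ?thesis .
qed

lemma flow_space_lipschitz:
  assumes t: "t > 0"
  shows "\<bar>Q t x - Q t z\<bar> \<le> \<alpha>' ((R t + dist x z) / t) * dist x z"
proof -
  have *: "Q t x - Q t z \<le> \<alpha>' ((R t + dist x z) / t) * dist x z" for x z
  proof -
    obtain y where y: "minimizer t z y" using minimizer_exists assms by blast
    have "dist x y \<le> R t + dist x z"
      using minimizer_dist[OF t y] dist_triangle[of x y z] by linarith
    then have "\<alpha>' (dist x y / t) * dist x z \<le> \<alpha>' ((R t + dist x z) / t) * dist x z"
      using t by (intro mult_right_mono deriv_mono divide_right_mono) auto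
    then show ?thesis using flow_space_le[OF t y, of x] by linarith
  qed
  show ?thesis using *[of x z] *[of z x] by (simp add: dist_commute abs_if)
qed

lemma continuous_flow:
  assumes t: "t > 0"
  shows "continuous_on UNIV (Q t)"
proof -
  have "isCont (Q t) x" for x
  proof -
    have "((\<lambda>z. Q t z - Q t x) \<longlongrightarrow> 0) (at x)"
    proof (rule Lim_null_comparison)
      have "eventually (\<lambda>z. dist z x < 1) (at x)" by (auto simp: eventually_at intro: exI[of _ 1])
      then show "eventually (\<lambda>z. norm (Q t z - Q t x) \<le> \<alpha>' ((R t + 1) / t) * dist z x) (at x)"
      proof eventually_elim
        case (elim z)
        have "\<bar>Q t z - Q t x\<bar> \<le> \<alpha>' ((R t + dist z x) / t) * dist z x" by (rule flow_space_lipschitz[OF t])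
        also have "\<dots> \<le> \<alpha>' ((R t + 1) / t) * dist z x"
          using elim t R_ge[of t] by (intro mult_right_mono deriv_mono divide_right_mono) auto
        finally show ?case by simp
      qed
      have "((\<lambda>z. \<alpha>' ((R t + 1) / t) * dist z x) \<longlongrightarrow> \<alpha>' ((R t + 1) / t) * dist x x) (at x)"
        by (intro tendsto_intros)
      then show "((\<lambda>z. \<alpha>' ((R t + 1) / t) * dist z x) \<longlongrightarrow> 0) (at x)" by simp
    qed
    then show ?thesis by (simp add: isCont_def LIM_zero_iff)
  qed
  then show ?thesis by (simp add: continuous_at_imp_continuous_on)
qed

section \<open>Stability of minimizers and the slope of the flow\<close>

lemma minimizer_limit:
  assumes t: "t > 0" and "z \<longlonglongrightarrow> x" "y \<longlonglongrightarrow> l" "\<And>n. minimizer t (z n) (y n)"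
  shows "minimizer t x l"
proof -
  have isc: "isCont (Q t) x" "isCont f l"
    using continuous_flow[OF t] cont by (auto simp: continuous_on_eq_continuous_at)
  have "(\<lambda>n. Q t (z n)) \<longlonglongrightarrow> Q t x" using isc assms(2) by (simp add: isCont_tendsto_compose)
  moreover have "(\<lambda>n. f (y n) + t * \<alpha> (dist (z n) (y n) / t)) \<longlonglongrightarrow> f l + t * \<alpha> (dist x l / t)"
  proof (intro tendsto_intros)
    show "(\<lambda>n. f (y n)) \<longlonglongrightarrow> f l" using isc assms(3) by (simp add: isCont_tendsto_compose)
    show "(\<lambda>n. \<alpha> (dist (z n) (y n) / t)) \<longlonglongrightarrow> \<alpha> (dist x l / t)"
    proof (rule continuous_on_tendsto_compose[OF continuous_cost])
      show "(\<lambda>n. dist (z n) (y n) / t) \<longlonglongrightarrow> dist x l / t"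
        using assms by (intro tendsto_intros) auto
    qed (use t in auto)
  qed
  ultimately show ?thesis using assms(4) LIMSEQ_unique by (auto simp: minimizer_def)
qed

lemma farthest_minimizer:
  assumes t: "t > 0"
  obtains y where "minimizer t x y" "\<And>y'. minimizer t x y' \<Longrightarrow> dist x y' \<le> dist x y"
proof -
  let ?Y = "{y. minimizer t x y}"
  have "closed ?Y" unfolding closed_sequential_limits
    using minimizer_limit[OF t, of "\<lambda>_. x" x] by auto
  then have "compact (cball x (R t) \<inter> ?Y)" by (rule compact_Int_closed[OF proper])
  moreover have "cball x (R t) \<inter> ?Y = ?Y" using minimizer_dist[OF t] by auto
  moreover have "?Y \<noteq> {}" using minimizer_exists[OF t] by auto
  moreover have "continuous_on ?Y (dist x)" by (intro continuous_intros)
  ultimately have "\<exists>y\<in>?Y. \<forall>y'\<in>?Y. dist x y' \<le> dist x y"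
    by (intro continuous_attains_sup) auto
  then show ?thesis using that by blast
qed

text \<open>Otherwise minimizers \<open>y n\<close> for centres \<open>z n\<close> tending to
  \<open>x\<close> stay at distance at least \<open>D\<close> from \<open>x\<close>. Compactness of
  balls gives a convergent subsequence, whose limit is a minimizer for \<open>x\<close> at distance
  at least \<open>D\<close>.\<close>

lemma eventually_minimizers_near:
  assumes t: "t > 0" and D: "\<And>y. minimizer t x y \<Longrightarrow> dist x y < D"
  shows "eventually (\<lambda>z. \<forall>y. minimizer t z y \<longrightarrow> dist x y < D) (at x)"
proof (rule ccontr)
  assume "\<not> ?thesis"
  then have "\<forall>n::nat. \<exists>z y. dist z x < inverse (Suc n) \<and> minimizer t z y \<and> dist x y \<ge> D"
    unfolding eventually_at by (metis inverse_positive_iff_positive not_less of_nat_0_less_iff zero_less_Suc)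
  then obtain z y where zy: "\<And>n::nat. dist (z n) x < inverse (Suc n)"
      "\<And>n. minimizer t (z n) (y n)" "\<And>n. dist x (y n) \<ge> D"
    by metis
  have "dist x (y n) \<le> R t + 1" for n
  proof -
    have "inverse (real (Suc n)) \<le> 1" by (simp add: field_simps)
    then show ?thesis
      using zy(1)[of n] minimizer_dist[OF t zy(2), of n] dist_triangle[of x "y n" "z n"]
      by (simp add: dist_commute)
  qed
  then have "\<And>n. y n \<in> cball x (R t + 1)" by simp
  then obtain l \<rho> where l: "strict_mono \<rho>" "(y \<circ> \<rho>) \<longlonglongrightarrow> l"
    using proper[of x "R t + 1"] unfolding compact_def by metis
  have "z \<longlonglongrightarrow> x"
  proof (rule tendstoI)
    fix e :: real assume "e > 0"
    then have "eventually (\<lambda>n. inverse (real (Suc n)) < e) sequentially"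
      by (rule order_tendstoD(2)[OF LIMSEQ_inverse_real_of_nat])
    then show "eventually (\<lambda>n. dist (z n) x < e) sequentially"
      by eventually_elim (use zy(1) in \<open>force intro: less_trans\<close>)
  qed
  then have "(z \<circ> \<rho>) \<longlonglongrightarrow> x" using l(1) by (rule LIMSEQ_subseq_LIMSEQ)
  then have "minimizer t x l"
    by (rule minimizer_limit[OF t _ l(2)]) (simp add: zy)
  then have "dist x l < D" by (rule D)
  moreover have "(\<lambda>n. dist x ((y \<circ> \<rho>) n)) \<longlonglongrightarrow> dist x l" using l(2) by (intro tendsto_intros)
  then have "D \<le> dist x l" by (rule LIMSEQ_le_const) (use zy in auto)
  ultimately show False by simp
qed

text \<open>By \<open>flow_space_le\<close> the slope is governed by minimizers for nearby points,
  and these are eventually no farther from \<open>x\<close> than its farthest minimizer plus any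
  \<open>e > 0\<close>. Continuity of \<open>\<alpha>'\<close> removes \<open>e\<close>.\<close>

lemma descending_slope_flow_le:
  assumes t: "t > 0" and \<kappa>: "\<kappa> > 0"
  obtains y where "minimizer t x y"
    "descending_slope (\<lambda>z. \<kappa> * Q t z) x \<le> ennreal (\<kappa> * \<alpha>' (dist x y / t))"
proof -
  obtain y where y: "minimizer t x y" "\<And>y'. minimizer t x y' \<Longrightarrow> dist x y' \<le> dist x y"
    using farthest_minimizer[OF t] by blast
  let ?D = "dist x y"
  let ?S = "descending_slope (\<lambda>z. \<kappa> * Q t z) x"
  have le: "?S \<le> ennreal (\<kappa> * \<alpha>' ((?D + e) / t))" if "e > 0" for e
    unfolding descending_slope_def
  proof (rule Limsup_bounded)
    have "eventually (\<lambda>z. \<forall>y. minimizer t z y \<longrightarrow> dist x y < ?D + e) (at x)"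
      using y(2) that by (intro eventually_minimizers_near[OF t]) force
    moreover have "eventually (\<lambda>z. z \<noteq> x) (at x)" by (simp add: eventually_at_filter)
    ultimately show "eventually (\<lambda>z. ennreal (max 0 (- (\<kappa> * Q t z - \<kappa> * Q t x)) / dist x z)
        \<le> ennreal (\<kappa> * \<alpha>' ((?D + e) / t))) (at x)"
    proof eventually_elim
      case (elim z)
      obtain w where w: "minimizer t z w" using minimizer_exists[OF t] by blast
      have "Q t x - Q t z \<le> \<alpha>' (dist x w / t) * dist x z" by (rule flow_space_le[OF t w])
      also have "\<dots> \<le> \<alpha>' ((?D + e) / t) * dist x z"
        using elim(1) w t by (intro mult_right_mono deriv_mono divide_right_mono) force+
      finally have "\<kappa> * (Q t x - Q t z) \<le> \<kappa> * (\<alpha>' ((?D + e) / t) * dist x z)"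
        using \<kappa> by simp
      moreover have "0 \<le> \<kappa> * (\<alpha>' ((?D + e) / t) * dist x z)"
        using \<kappa> t that by (intro mult_nonneg_nonneg deriv_nonneg) auto
      ultimately have "max 0 (- (\<kappa> * Q t z - \<kappa> * Q t x)) \<le> \<kappa> * \<alpha>' ((?D + e) / t) * dist x z"
        by (simp add: algebra_simps)
      then show ?case using elim(2) by (intro ennreal_leI) (simp add: pos_divide_le_eq)
    qed
  qed
  have "continuous_on {0..} (\<lambda>e. \<kappa> * \<alpha>' ((?D + e) / t))"
    by (intro continuous_on_mult continuous_on_const continuous_on_compose2[OF C1])
      (use t in \<open>auto intro!: continuous_intros\<close>)
  then have "((\<lambda>e. \<kappa> * \<alpha>' ((?D + e) / t)) \<longlongrightarrow> \<kappa> * \<alpha>' ((?D + 0) / t)) (at 0 within {0..})"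
    unfolding continuous_on_def by (rule bspec) simp
  then have "((\<lambda>e. \<kappa> * \<alpha>' ((?D + e) / t)) \<longlongrightarrow> \<kappa> * \<alpha>' ((?D + 0) / t)) (at_right 0)"
    by (rule tendsto_within_subset) auto
  then have lim: "((\<lambda>e. ennreal (\<kappa> * \<alpha>' ((?D + e) / t))) \<longlongrightarrow> ennreal (\<kappa> * \<alpha>' ((?D + 0) / t))) (at_right 0)"
    by (rule tendsto_ennrealI)
  have "eventually (\<lambda>e. ?S \<le> ennreal (\<kappa> * \<alpha>' ((?D + e) / t))) (at_right 0)"
    using le by (auto simp: eventually_at_filter)
  then have "?S \<le> ennreal (\<kappa> * \<alpha>' ((?D + 0) / t))"
    by (rule tendsto_lowerbound[OF lim]) simp
  then show ?thesis using that y(1) by simp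
qed

lemma scaled_flow_in_F_class:
  assumes t: "t > 0" and \<kappa>: "\<kappa> > 0"
    and adm: "\<kappa> \<le> 1 \<or> Lim at_top (\<lambda>h. ennreal (\<alpha> h / h)) = \<top>"
  shows "(\<lambda>x. \<kappa> * Q t x) \<in> F_class \<alpha>"
proof -
  have quot: "ennreal (\<bar>\<kappa> * Q t y - \<kappa> * Q t x\<bar> / dist x y) \<le> ennreal (\<kappa> * \<alpha>' ((R t + dist x y) / t))"
    if "x \<noteq> y" for x y
  proof (rule ennreal_leI)
    have "\<bar>\<kappa> * Q t y - \<kappa> * Q t x\<bar> = \<kappa> * \<bar>Q t x - Q t y\<bar>"
      using \<kappa> by (simp add: abs_mult abs_minus_commute flip: right_diff_distrib)
    also have "\<dots> \<le> \<kappa> * (\<alpha>' ((R t + dist x y) / t) * dist x y)"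
      using \<kappa> flow_space_lipschitz[OF t] by simp
    finally show "\<bar>\<kappa> * Q t y - \<kappa> * Q t x\<bar> / dist x y \<le> \<kappa> * \<alpha>' ((R t + dist x y) / t)"
      using that by (simp add: pos_divide_le_eq mult.assoc)
  qed
  have "bounded (range (\<lambda>x. \<kappa> * Q t x))"
  proof (rule boundedI)
    fix z assume "z \<in> range (\<lambda>x. \<kappa> * Q t x)"
    then show "norm z \<le> \<kappa> * B" using \<kappa> flow_bound[OF t] by (auto simp: abs_mult)
  qed
  moreover have "Lip_upto (\<lambda>x. \<kappa> * Q t x) 1 \<le> ennreal (\<kappa> * \<alpha>' ((R t + 1) / t))"
    unfolding Lip_upto_def
  proof (rule SUP_least, clarify)
    fix x y :: 'a assume xy: "x \<noteq> y" "dist x y \<le> 1"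
    have "ennreal (\<kappa> * \<alpha>' ((R t + dist x y) / t)) \<le> ennreal (\<kappa> * \<alpha>' ((R t + 1) / t))"
      using xy t \<kappa> R_ge[of t] by (intro ennreal_leI mult_left_mono deriv_mono divide_right_mono) auto
    then show "ennreal (\<bar>\<kappa> * Q t y - \<kappa> * Q t x\<bar> / dist x y) \<le> ennreal (\<kappa> * \<alpha>' ((R t + 1) / t))"
      using quot[OF xy(1)] by (rule order_trans[rotated])
  qed
  then have "\<exists>r>0. Lip_upto (\<lambda>x. \<kappa> * Q t x) r < \<infinity>"
    by (intro exI[of _ 1]) (auto intro: le_less_trans)
  moreover have "Lip (\<lambda>x. \<kappa> * Q t x) \<le> Lim at_top (\<lambda>h. ennreal (\<alpha> h / h))"
  proof (cases "Lim at_top (\<lambda>h. ennreal (\<alpha> h / h)) = \<top>")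
    case False
    then have k1: "\<kappa> \<le> 1" using adm by simp
    show ?thesis unfolding Lip_def Lip_upto_def
    proof (intro SUP_least, clarify)
      fix x y :: 'a assume "x \<noteq> y"
      have h: "(R t + dist x y) / t \<ge> 0" using t R_ge[of t] by simp
      have "ennreal (\<kappa> * \<alpha>' ((R t + dist x y) / t)) \<le> ennreal (\<alpha>' ((R t + dist x y) / t))"
        using k1 \<kappa> deriv_nonneg[OF h] by (intro ennreal_leI) (simp add: mult_left_le_one_le)
      also have "\<dots> \<le> Lim at_top (\<lambda>h. ennreal (\<alpha> h / h))" by (rule deriv_le_Lim_ratio[OF h])
      finally show "ennreal (\<bar>\<kappa> * Q t y - \<kappa> * Q t x\<bar> / dist x y) \<le> Lim at_top (\<lambda>h. ennreal (\<alpha> h / h))"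
        using quot[OF \<open>x \<noteq> y\<close>] by (rule order_trans[rotated])
    qed
  qed simp
  ultimately show ?thesis by (simp add: F_class_def)
qed

end

subsection \<open>From the log-Sobolev inequality to hypercontractivity\<close>

lemma conjugate_mono: "u \<le> v \<Longrightarrow> conjugate \<alpha> u \<le> conjugate \<alpha> v"
  unfolding conjugate_def by (intro SUP_mono) (auto intro!: bexI ennreal_minus_mono mult_left_mono)

section \<open>Integrals of exponentials of bounded functions\<close>

context prob_space
begin

lemma integrable_of_abs_bound:
  fixes g :: "'a \<Rightarrow> real"
  assumes "g \<in> borel_measurable M" "\<And>x. \<bar>g x\<bar> \<le> b"
  shows "integrable M g"
  using assms by (intro integrable_const_bound[of _ b]) auto

lemma integrable_exp:
  fixes g :: "'a \<Rightarrow> real"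
  assumes [measurable]: "g \<in> borel_measurable M" and "\<And>x. \<bar>g x\<bar> \<le> b"
  shows "integrable M (\<lambda>x. exp (g x))"
proof (rule integrable_of_abs_bound)
  show "\<bar>exp (g x)\<bar> \<le> exp b" for x using assms(2)[of x] by simp
qed simp

lemma integrable_mult_exp:
  fixes g h :: "'a \<Rightarrow> real"
  assumes [measurable]: "g \<in> borel_measurable M" "h \<in> borel_measurable M"
    and "\<And>x. \<bar>g x\<bar> \<le> b" "\<And>x. \<bar>h x\<bar> \<le> a"
  shows "integrable M (\<lambda>x. h x * exp (g x))"
proof (rule integrable_of_abs_bound)
  fix x
  have "\<bar>h x\<bar> * exp (g x) \<le> a * exp b"
    using assms(3)[of x] assms(4)[of x] by (intro mult_mono) auto
  then show "\<bar>h x * exp (g x)\<bar> \<le> a * exp b" by (simp add: abs_mult)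
qed simp

lemma integral_exp_pos:
  fixes g :: "'a \<Rightarrow> real"
  assumes "g \<in> borel_measurable M" and "\<And>x. \<bar>g x\<bar> \<le> b"
  shows "(\<integral>x. exp (g x) \<partial>M) > 0"
proof -
  have "(\<integral>x. exp (-b) \<partial>M) \<le> (\<integral>x. exp (g x) \<partial>M)"
  proof (rule integral_mono[OF _ integrable_exp[OF assms]])
    show "exp (-b) \<le> exp (g x)" for x using assms(2)[of x] by simp
  qed simp_all
  moreover have "(\<integral>x. exp (-b) \<partial>M) = exp (-b)" by (simp add: prob_space)
  ultimately show ?thesis by (smt (verit) exp_gt_zero)
qed

lemma Ent_exp:
  fixes g :: "'a \<Rightarrow> real"
  assumes "g \<in> borel_measurable M" and "\<And>x. \<bar>g x\<bar> \<le> b"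
  shows "Ent M (\<lambda>x. exp (g x)) =
    (\<integral>x. g x * exp (g x) \<partial>M) - (\<integral>x. exp (g x) \<partial>M) * ln (\<integral>x. exp (g x) \<partial>M)"
proof -
  let ?Z = "\<integral>x. exp (g x) \<partial>M"
  have "?Z > 0" by (rule integral_exp_pos[OF assms])
  then have "exp (g x) * ln (exp (g x) / ?Z) = g x * exp (g x) - ln ?Z * exp (g x)" for x
    by (simp add: ln_div algebra_simps)
  then have "Ent M (\<lambda>x. exp (g x)) = (\<integral>x. g x * exp (g x) - ln ?Z * exp (g x) \<partial>M)"
    by (simp add: Ent_def)
  also have "\<dots> = (\<integral>x. g x * exp (g x) \<partial>M) - ln ?Z * ?Z"
    using integrable_exp[OF assms] integrable_mult_exp[OF assms(1) assms(1) assms(2) assms(2)]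
    by (subst Bochner_Integration.integral_diff) auto
  finally show ?thesis by (simp add: mult.commute)
qed

lemma integral_exp_scale_le:
  fixes g :: "'a \<Rightarrow> real"
  assumes g[measurable]: "g \<in> borel_measurable M" and b: "\<And>x. \<bar>g x\<bar> \<le> b"
  shows "(\<integral>x. exp (k' * g x) \<partial>M) \<le> exp (\<bar>k' - k\<bar> * b) * (\<integral>x. exp (k * g x) \<partial>M)"
proof -
  have int: "integrable M (\<lambda>x. exp (k * g x))" for k
  proof (rule integrable_exp)
    show "\<bar>k * g x\<bar> \<le> \<bar>k\<bar> * b" for x using b[of x] by (simp add: abs_mult mult_left_mono)
  qed simp
  have "(\<integral>x. exp (k' * g x) \<partial>M) \<le> (\<integral>x. exp (\<bar>k' - k\<bar> * b) * exp (k * g x) \<partial>M)"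
  proof (rule integral_mono[OF int])
    fix x
    have "(k' - k) * g x \<le> \<bar>k' - k\<bar> * b"
      using b[of x] abs_le_iff abs_mult mult_left_mono[OF b, of "\<bar>k' - k\<bar>" x] by (smt (verit))
    then show "exp (k' * g x) \<le> exp (\<bar>k' - k\<bar> * b) * exp (k * g x)"
      by (simp add: algebra_simps flip: exp_add)
  qed (use int in simp)
  then show ?thesis using int by simp
qed

end

locale hopf_lax_measure = hopf_lax_flow \<alpha> \<alpha>' f B + prob_space \<mu>
  for \<alpha> \<alpha>' and f :: "'a::metric_space \<Rightarrow> real" and B and \<mu> :: "'a measure" +
  assumes borel: "sets \<mu> = sets borel"
begin

lemma measurable_of_continuous:
  fixes g :: "'a \<Rightarrow> real"
  shows "continuous_on UNIV g \<Longrightarrow> g \<in> borel_measurable \<mu>"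
  using borel_measurable_continuous_onI measurable_cong_sets[OF borel refl] by blast

lemma measurable_flow: "t > 0 \<Longrightarrow> Q t \<in> borel_measurable \<mu>"
  by (intro measurable_of_continuous continuous_flow)

lemma scaled_flow_bound: "t > 0 \<Longrightarrow> \<kappa> \<ge> 0 \<Longrightarrow> \<bar>\<kappa> * Q t x\<bar> \<le> \<kappa> * B"
  using flow_bound[of t x] by (simp add: abs_mult mult_left_mono)

text \<open>Fatou's lemma transfers the pointwise bound on the slope of the flow to its time derivative.\<close>
lemma entropy_le_energy:
  assumes LSI: "LSI_minus \<alpha> C \<mu>" and C: "C > 0" and t: "t > 0" and \<kappa>: "\<kappa> > 0" and m: "m > 0"
    and scale: "\<And>g h. g \<ge> 0 \<Longrightarrow> h \<ge> 0 \<Longrightarrow> g * (\<kappa> * \<alpha>' h) - \<alpha> g \<le> m * \<beta> h"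
    and adm: "(\<lambda>x. \<kappa> * Q t x) \<in> F_class \<alpha>" and \<eta>: "\<eta> > 0"
  shows "eventually (\<lambda>s. Ent \<mu> (\<lambda>x. exp (\<kappa> * Q t x)) / (C * m) - \<eta>
      \<le> (\<integral>x. (Q t x - Q (t + s) x) / s * exp (\<kappa> * Q t x) \<partial>\<mu>)) (at_right 0)"
proof (rule sequentially_imp_eventually_at_right[of 0 1])
  \<comment> \<open>Fatou's lemma works along sequences, so the right limit is tested on arbitrary
    sequences decaying to 0.\<close>
  fix s :: "nat \<Rightarrow> real"
  assume s_pos: "\<And>n. 0 < s n" and s_lt: "\<And>n. s n < 1" and s_lim: "s \<longlonglongrightarrow> 0"
  have ts: "t + s n > 0" for n using t s_pos[of n] by simp
  note meas [measurable] = measurable_flow[OF t] measurable_flow[OF ts]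
  define E where "E = Ent \<mu> (\<lambda>x. exp (\<kappa> * Q t x))"
  define w where "w n x = (Q t x - Q (t + s n) x) / s n" for n x
  define I where "I n = (\<integral>x. w n x * exp (\<kappa> * Q t x) \<partial>\<mu>)" for n
  have w_nonneg: "w n x \<ge> 0" for n x
    using s_pos[of n] t flow_antimono[of t "t + s n" x] by (simp add: w_def)
  have w_le: "w n x \<le> \<beta> (R (t + 1) / t)" for n x
    using flow_time_lipschitz[OF t, of "s n" x] s_pos[of n] s_lt[of n]
    by (simp add: w_def divide_le_eq mult.commute)
  have w_meas [measurable]: "w n \<in> borel_measurable \<mu>" for n unfolding w_def by measurable
  have int: "integrable \<mu> (\<lambda>x. w n x * exp (\<kappa> * Q t x))" for n
    by (rule integrable_mult_exp[where b = "\<kappa> * B" and a = "\<beta> (R (t + 1) / t)"])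
      (use scaled_flow_bound t \<kappa> w_nonneg w_le in auto)
  have I_nonneg: "I n \<ge> 0" for n
    unfolding I_def by (intro integral_nonneg_AE AE_I2 mult_nonneg_nonneg w_nonneg) simp
  have pointwise: "conjugate \<alpha> (descending_slope (\<lambda>x. \<kappa> * Q t x) x) * ennreal (exp (\<kappa> * Q t x))
      \<le> liminf (\<lambda>n. ennreal (m * (w n x * exp (\<kappa> * Q t x))))" for x
  proof -
    let ?e = "exp (\<kappa> * Q t x)"
    obtain y where y: "minimizer t x y"
      "descending_slope (\<lambda>z. \<kappa> * Q t z) x \<le> ennreal (\<kappa> * \<alpha>' (dist x y / t))"
      using descending_slope_flow_le[OF t \<kappa>] by blast
    have "conjugate \<alpha> (descending_slope (\<lambda>x. \<kappa> * Q t x) x) \<le> conjugate \<alpha> (ennreal (\<kappa> * \<alpha>' (dist x y / t)))"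
      by (rule conjugate_mono[OF y(2)])
    also have "\<dots> \<le> ennreal (m * \<beta> (dist x y / t))"
      using t \<kappa> by (intro conjugate_le mult_nonneg_nonneg deriv_nonneg scale) auto
    finally have "conjugate \<alpha> (descending_slope (\<lambda>x. \<kappa> * Q t x) x) * ennreal ?e
        \<le> ennreal (m * \<beta> (dist x y / t)) * ennreal ?e"
      by (rule mult_right_mono) simp
    also have "\<dots> = ennreal (m * (\<beta> (dist x y / t) * ?e))"
      using m t by (simp add: \<beta>_nonneg mult.assoc flip: ennreal_mult)
    \<comment> \<open>At positive \<open>s n\<close> the loss in time is bounded by \<beta> at
      \<open>dist x y / (t + s n)\<close>, not at \<open>dist x y / t\<close>; continuity of \<beta>
      closes the gap in the limit.\<close>
    also have "\<dots> = liminf (\<lambda>n. ennreal (m * (\<beta> (dist x y / (t + s n)) * ?e)))"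
    proof (rule lim_imp_Liminf[symmetric])
      have "(\<lambda>n. \<beta> (dist x y / (t + s n))) \<longlonglongrightarrow> \<beta> (dist x y / t)"
      proof (rule continuous_on_tendsto_compose[OF continuous_\<beta>])
        have "(\<lambda>n. dist x y / (t + s n)) \<longlonglongrightarrow> dist x y / (t + 0)"
          using s_lim t by (intro tendsto_intros) auto
        then show "(\<lambda>n. dist x y / (t + s n)) \<longlonglongrightarrow> dist x y / t" by simp
      qed (use t ts in \<open>auto intro!: always_eventually divide_nonneg_pos\<close>)
      then show "(\<lambda>n. ennreal (m * (\<beta> (dist x y / (t + s n)) * ?e))) \<longlonglongrightarrow> ennreal (m * (\<beta> (dist x y / t) * ?e))"
        by (intro tendsto_intros)
    qed simp
    also have "\<dots> \<le> liminf (\<lambda>n. ennreal (m * (w n x * ?e)))"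
    proof (intro Liminf_mono always_eventually allI ennreal_leI mult_left_mono mult_right_mono)
      fix n
      show "\<beta> (dist x y / (t + s n)) \<le> w n x"
        using flow_time_decrease[OF t _ y(1), of "s n"] s_pos[of n]
        by (simp add: w_def pos_le_divide_eq mult.commute)
    qed (use m in auto)
    finally show ?thesis .
  qed
  have "ennreal E \<le> ennreal C * (\<integral>\<^sup>+x. conjugate \<alpha> (descending_slope (\<lambda>x. \<kappa> * Q t x) x) * ennreal (exp (\<kappa> * Q t x)) \<partial>\<mu>)"
    unfolding E_def by (rule bspec[OF LSI[unfolded LSI_minus_def] adm])
  also have "\<dots> \<le> ennreal C * (\<integral>\<^sup>+x. liminf (\<lambda>n. ennreal (m * (w n x * exp (\<kappa> * Q t x)))) \<partial>\<mu>)"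
    by (intro mult_left_mono nn_integral_mono pointwise) simp
  also have "\<dots> \<le> ennreal C * liminf (\<lambda>n. \<integral>\<^sup>+x. ennreal (m * (w n x * exp (\<kappa> * Q t x))) \<partial>\<mu>)"
    by (intro mult_left_mono nn_integral_liminf) auto
  also have "(\<lambda>n. \<integral>\<^sup>+x. ennreal (m * (w n x * exp (\<kappa> * Q t x))) \<partial>\<mu>) = (\<lambda>n. ennreal (m * I n))"
  proof
    fix n
    have "(\<integral>\<^sup>+x. ennreal (m * (w n x * exp (\<kappa> * Q t x))) \<partial>\<mu>) = ennreal (\<integral>x. m * (w n x * exp (\<kappa> * Q t x)) \<partial>\<mu>)"
      using int[of n] m w_nonneg by (intro nn_integral_eq_integral) auto
    then show "(\<integral>\<^sup>+x. ennreal (m * (w n x * exp (\<kappa> * Q t x))) \<partial>\<mu>) = ennreal (m * I n)"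
      using int[of n] by (simp add: I_def)
  qed
  finally have main: "ennreal E \<le> ennreal C * liminf (\<lambda>n. ennreal (m * I n))" .
  have "eventually (\<lambda>n. E / (C * m) - \<eta> \<le> I n) sequentially"
  proof (cases "E > 0")
    \<comment> \<open>The embedding into \<open>ennreal\<close> forgets negative values of
      \<open>E\<close>; there the claim holds because the time quotients are nonnegative.\<close>
    case False
    then have "E / (C * m) \<le> 0" using C m by (simp add: divide_le_0_iff)
    then have "E / (C * m) - \<eta> \<le> I n" for n using I_nonneg[of n] \<eta> by linarith
    then show ?thesis by simp
  next
    case True
    have "ennreal C * ennreal (E / C) \<le> ennreal C * liminf (\<lambda>n. ennreal (m * I n))"
      using main C True by (simp flip: ennreal_mult)
    then have "ennreal (E / C) \<le> liminf (\<lambda>n. ennreal (m * I n))"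
      using C by (simp add: ennreal_mult_le_mult_iff)
    \<comment> \<open>The loss \<eta> creates the strict inequality that passes from a lower limit
      to the tail of the sequence.\<close>
    moreover have "ennreal (E / C - m * \<eta>) < ennreal (E / C)"
      using True C m \<eta> by (intro ennreal_lessI) auto
    ultimately have "ennreal (E / C - m * \<eta>) < liminf (\<lambda>n. ennreal (m * I n))" by simp
    then have "eventually (\<lambda>n. ennreal (E / C - m * \<eta>) < ennreal (m * I n)) sequentially"
      by (rule less_LiminfD)
    then show ?thesis
    proof eventually_elim
      case (elim n)
      have "E / C - m * \<eta> \<le> m * I n"
      proof (rule ccontr)
        assume "\<not> ?thesis"
        then have "ennreal (m * I n) \<le> ennreal (E / C - m * \<eta>)" by (intro ennreal_leI) simp
        then show False using elim by simp
      qed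
      then have "E / C \<le> m * (I n + \<eta>)" by (simp add: algebra_simps)
      then have "E / C / m \<le> m * (I n + \<eta>) / m" by (rule divide_right_mono) (use m in simp)
      then show ?case using m by simp
    qed
  qed
  then show "eventually (\<lambda>n. Ent \<mu> (\<lambda>x. exp (\<kappa> * Q t x)) / (C * m) - \<eta>
      \<le> (\<integral>x. (Q t x - Q (t + s n) x) / s n * exp (\<kappa> * Q t x) \<partial>\<mu>)) sequentially"
    by (simp add: E_def I_def w_def)
qed simp

text \<open>For \<open>\<kappa> > 0\<close> the logarithm of the \<kappa>-norm of the exponential of
  the flow. Exponent and time are separate arguments, since some estimates vary only one of
  them.\<close>

definition H :: "real \<Rightarrow> real \<Rightarrow> real" where
  "H \<kappa> t = ln (\<integral>x. exp (\<kappa> * Q t x) \<partial>\<mu>) / \<kappa>"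

text \<open>With \<open>c = H (K t) t\<close>, the claim says that
  \<open>exp (K' * (Q (t + s) x - c - \<epsilon> * s))\<close> has integral at most 1. Its ratio to
  the probability density \<open>exp (\<kappa> * (Q t x - c))\<close> is \<open>exp (A x)\<close>
  with \<open>A\<close> of order \<open>s\<close>, so first-order terms decide: the change of
  exponent contributes entropy, the loss in time contributes energy, and \<open>k1\<close> is the
  rate at which \<open>entropy_le_energy\<close> balances them. The slack \<epsilon> absorbs the
  errors.\<close>

lemma H_right_dini:
  assumes LSI: "LSI_minus \<alpha> C \<mu>" and C: "C > 0" and t: "t > 0" and \<kappa>: "K t > 0" and m: "m > 0"
    and scale: "\<And>g h. g \<ge> 0 \<Longrightarrow> h \<ge> 0 \<Longrightarrow> g * (K t * \<alpha>' h) - \<alpha> g \<le> m * \<beta> h"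
    and adm: "(\<lambda>x. K t * Q t x) \<in> F_class \<alpha>"
    and K: "((\<lambda>s. (K (t + s) - K t) / s) \<longlongrightarrow> k1) (at_right 0)"
    and k1: "k1 * C * m = (K t)\<^sup>2" and \<epsilon>: "\<epsilon> > 0"
  shows "eventually (\<lambda>s. H (K (t + s)) (t + s) \<le> H (K t) t + \<epsilon> * s) (at_right 0)"
proof -
  define \<kappa> where "\<kappa> = K t"
  have \<kappa>_pos: "\<kappa> > 0" using \<kappa> by (simp add: \<kappa>_def)
  define \<delta> where "\<delta> s = (K (t + s) - K t) / s" for s
  define Z where "Z = (\<integral>x. exp (\<kappa> * Q t x) \<partial>\<mu>)"
  define c where "c = ln Z / \<kappa>"
  define E where "E = Ent \<mu> (\<lambda>x. exp (\<kappa> * Q t x))"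
  define N where "N = \<beta> (R (t + 1) / t)"
  define k2 where "k2 = \<bar>k1\<bar> + 1"
  \<comment> \<open>One summand for each term of \<open>A_eq\<close>, using that the quotient
    \<delta> is below \<open>k2\<close>, that the loss in time is at most \<open>s * N\<close>, and
    that \<open>s < 1\<close>.\<close>
  define M where "M = k2 * (B + \<bar>c\<bar>) + k2 * N + \<kappa> * N + (\<kappa> + k2) * \<epsilon>"
  note Qt_meas [measurable] = measurable_flow[OF t]
  have kQ_meas: "(\<lambda>x. \<kappa> * Q t x) \<in> borel_measurable \<mu>" by simp
  have kQ_bound: "\<bar>\<kappa> * Q t x\<bar> \<le> \<kappa> * B" for x using t \<kappa>_pos by (intro scaled_flow_bound) auto
  have intU: "integrable \<mu> (\<lambda>x. exp (\<kappa> * Q t x))" by (rule integrable_exp[OF kQ_meas kQ_bound])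
  have Z: "Z > 0" unfolding Z_def by (rule integral_exp_pos[OF kQ_meas kQ_bound])
  have \<kappa>c: "\<kappa> * c = ln Z" using \<kappa>_pos by (simp add: c_def)
  have N: "N \<ge> 0" unfolding N_def using t R_ge[of "t + 1"] by (intro \<beta>_nonneg) simp
  have k2: "k2 > 0" by (simp add: k2_def)
  have intqU: "integrable \<mu> (\<lambda>x. Q t x * exp (\<kappa> * Q t x))"
    by (rule integrable_mult_exp[OF kQ_meas Qt_meas kQ_bound flow_bound[OF t]])
  have E_eq: "(\<integral>x. (Q t x - c) * exp (\<kappa> * Q t x) \<partial>\<mu>) = E / \<kappa>"
  proof -
    have "E = (\<integral>x. \<kappa> * (Q t x * exp (\<kappa> * Q t x)) \<partial>\<mu>) - Z * ln Z"
      unfolding E_def Z_def by (subst Ent_exp[OF kQ_meas kQ_bound]) (simp add: mult.assoc)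
    also have "\<dots> = \<kappa> * ((\<integral>x. Q t x * exp (\<kappa> * Q t x) \<partial>\<mu>) - c * Z)"
      using intqU \<kappa>c by (simp add: algebra_simps)
    also have "(\<integral>x. Q t x * exp (\<kappa> * Q t x) \<partial>\<mu>) - c * Z = (\<integral>x. (Q t x - c) * exp (\<kappa> * Q t x) \<partial>\<mu>)"
      unfolding Z_def left_diff_distrib using intqU intU
      by (subst Bochner_Integration.integral_diff) auto
    finally show ?thesis using \<kappa>_pos by simp
  qed
  \<comment> \<open>Half of the gain \<open>\<epsilon> * Z\<close> pays for the error in the energy
    bound; the other half keeps the limit of \<open>L\<close> negative.\<close>
  define \<eta> where "\<eta> = \<epsilon> * Z / 2"
  have \<eta>: "\<eta> > 0" using \<epsilon> Z by (simp add: \<eta>_def)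
  have \<delta>_lim: "(\<delta> \<longlongrightarrow> k1) (at_right 0)" using K by (simp add: \<delta>_def[abs_def])
  have id_lim: "((\<lambda>s. s) \<longlongrightarrow> 0) (at_right (0::real))" by (rule tendsto_ident_at)
  \<comment> \<open>\<open>Z + s * L s\<close> is going to bound the perturbed integral. In the
    limit the equation for \<open>k1\<close> cancels the two entropy terms and leaves
    \<open>- \<kappa> * \<epsilon> * Z / 2\<close>.\<close>
  define L where "L s = \<delta> s * (E / \<kappa>) + (k2 * N + M\<^sup>2) * s * Z
      - \<kappa> * (E / (C * m) - \<eta>) - (\<kappa> + s * \<delta> s) * \<epsilon> * Z" for s
  have "(L \<longlongrightarrow> k1 * (E / \<kappa>) + (k2 * N + M\<^sup>2) * 0 * Z
      - \<kappa> * (E / (C * m) - \<eta>) - (\<kappa> + 0 * k1) * \<epsilon> * Z) (at_right 0)"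
    unfolding L_def[abs_def] by (intro tendsto_intros \<delta>_lim id_lim)
  moreover have "k1 * (E / \<kappa>) + (k2 * N + M\<^sup>2) * 0 * Z
      - \<kappa> * (E / (C * m) - \<eta>) - (\<kappa> + 0 * k1) * \<epsilon> * Z = - \<kappa> * \<epsilon> * Z / 2"
  proof -
    have "k1 = \<kappa>\<^sup>2 / (C * m)" using k1 C m by (simp add: \<kappa>_def field_simps)
    then have "k1 * (E / \<kappa>) = \<kappa> * (E / (C * m))" using \<kappa>_pos by (simp add: power2_eq_square)
    then show ?thesis by (simp add: \<eta>_def algebra_simps)
  qed
  moreover have "- \<kappa> * \<epsilon> * Z / 2 < 0" using \<kappa>_pos \<epsilon> Z by simp
  ultimately have ev_L: "eventually (\<lambda>s. L s < 0) (at_right 0)"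
    by (metis order_tendstoD(2))
  have ev_\<delta>: "eventually (\<lambda>s. \<bar>\<delta> s\<bar> < k2) (at_right 0)"
    using tendsto_rabs[OF \<delta>_lim] by (rule order_tendstoD) (simp add: k2_def)
  have "((\<lambda>s. M * s) \<longlongrightarrow> M * 0) (at_right 0)" by (intro tendsto_intros id_lim)
  then have ev_M: "eventually (\<lambda>s. M * s < 1) (at_right 0)" by (rule order_tendstoD) simp
  have "((\<lambda>s. \<kappa> + s * \<delta> s) \<longlongrightarrow> \<kappa> + 0 * k1) (at_right 0)" by (intro tendsto_intros id_lim \<delta>_lim)
  then have ev_K: "eventually (\<lambda>s. 0 < \<kappa> + s * \<delta> s) (at_right 0)"
    by (rule order_tendstoD) (use \<kappa>_pos in simp)
  have ev_1: "eventually (\<lambda>s::real. 0 < s \<and> s < 1) (at_right 0)"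
    by (auto simp: eventually_at_right[OF zero_less_one] intro: exI[of _ 1])
  have ev_I: "eventually (\<lambda>s. E / (C * m) - \<eta>
      \<le> (\<integral>x. (Q t x - Q (t + s) x) / s * exp (\<kappa> * Q t x) \<partial>\<mu>)) (at_right 0)"
    unfolding E_def
    by (rule entropy_le_energy[OF LSI C t \<kappa>_pos m _ _ \<eta>]) (use scale adm in \<open>auto simp: \<kappa>_def\<close>)
  show ?thesis
    using ev_L ev_\<delta> ev_M ev_K ev_1 ev_I
  proof eventually_elim
    case (elim s)
    then have s: "0 < s" "s < 1" "M * s < 1" "\<bar>\<delta> s\<bar> < k2" by auto
    have ts: "t + s > 0" using t s by simp
    note [measurable] = measurable_flow[OF ts]
    define K' where "K' = \<kappa> + s * \<delta> s"
    have K'_eq: "K (t + s) = K'" using s by (simp add: K'_def \<delta>_def \<kappa>_def)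
    have K'_pos: "K' > 0" using elim by (simp add: K'_def)
    define w where "w x = Q t x - Q (t + s) x" for x
    have w_nonneg: "0 \<le> w x" for x using flow_antimono[OF t, of "t + s" x] s by (simp add: w_def)
    have w_le: "w x \<le> s * N" for x
      using flow_time_lipschitz[OF t, of s x] s by (simp add: w_def N_def)
    define I where "I = (\<integral>x. w x / s * exp (\<kappa> * Q t x) \<partial>\<mu>)"
    have I: "E / (C * m) - \<eta> \<le> I" using elim by (simp add: I_def w_def)
    have intwU: "integrable \<mu> (\<lambda>x. w x / s * exp (\<kappa> * Q t x))"
    proof (rule integrable_mult_exp[OF kQ_meas _ kQ_bound])
      show "\<bar>w x / s\<bar> \<le> N" for x using w_nonneg[of x] w_le[of x] s by (simp add: field_simps)
    qed (simp add: w_def)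
    define A where "A x = K' * (Q (t + s) x - c - \<epsilon> * s) - \<kappa> * (Q t x - c)" for x
    have A_eq: "A x = s * \<delta> s * (Q t x - c) - s * \<delta> s * w x - \<kappa> * w x - K' * \<epsilon> * s" for x
      by (simp add: A_def w_def K'_def algebra_simps)
    have K'_le: "K' \<le> \<kappa> + k2"
    proof -
      have "s * \<bar>\<delta> s\<bar> \<le> 1 * k2" using s k2 by (intro mult_mono) auto
      moreover have "s * \<delta> s \<le> s * \<bar>\<delta> s\<bar>" using s by simp
      ultimately show ?thesis by (simp add: K'_def)
    qed
    have dw: "\<bar>s * \<delta> s * w x\<bar> \<le> k2 * N * s\<^sup>2" for x
    proof -
      have "\<bar>s * \<delta> s * w x\<bar> = s * \<bar>\<delta> s\<bar> * w x" using s w_nonneg[of x] by (simp add: abs_mult)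
      also have "\<dots> \<le> s * k2 * (s * N)"
        using s w_le[of x] w_nonneg[of x] k2 by (intro mult_mono) auto
      finally show ?thesis by (simp add: power2_eq_square algebra_simps)
    qed
    have A_bound: "\<bar>A x\<bar> \<le> M * s" for x
    proof -
      have "\<bar>s * \<delta> s * (Q t x - c)\<bar> \<le> s * k2 * (B + \<bar>c\<bar>)"
      proof -
        have "\<bar>Q t x - c\<bar> \<le> B + \<bar>c\<bar>" using flow_bound[OF t, of x] by linarith
        then have "s * \<bar>\<delta> s\<bar> * \<bar>Q t x - c\<bar> \<le> s * k2 * (B + \<bar>c\<bar>)"
          using s k2 by (intro mult_mono) auto
        then show ?thesis using s by (simp add: abs_mult)
      qed
      moreover have "\<bar>s * \<delta> s * w x\<bar> \<le> k2 * N * s"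
      proof -
        have "s\<^sup>2 \<le> s" using s by (simp add: power2_eq_square)
        then have "k2 * N * s\<^sup>2 \<le> k2 * N * s" using k2 N by (intro mult_left_mono) auto
        then show ?thesis using dw[of x] by linarith
      qed
      moreover have "\<bar>\<kappa> * w x\<bar> \<le> \<kappa> * (s * N)"
        using \<kappa>_pos w_nonneg[of x] w_le[of x] by (simp add: abs_mult)
      moreover have "\<bar>K' * \<epsilon> * s\<bar> \<le> (\<kappa> + k2) * \<epsilon> * s"
        using K'_le K'_pos \<epsilon> s by (simp add: abs_mult)
      ultimately show ?thesis unfolding A_eq M_def by (simp add: algebra_simps)
    qed
    have exp_A: "exp (A x) * exp (\<kappa> * Q t x) \<le> (1 + M\<^sup>2 * s\<^sup>2 + k2 * N * s\<^sup>2 - K' * \<epsilon> * s) * exp (\<kappa> * Q t x)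
        + s * \<delta> s * ((Q t x - c) * exp (\<kappa> * Q t x)) - \<kappa> * s * (w x / s * exp (\<kappa> * Q t x))" for x
    proof -
      have "exp (A x) \<le> 1 + A x + (A x)\<^sup>2"
        using A_bound[of x] s by (intro exp_le_one_plus_square) linarith
      also have "(A x)\<^sup>2 \<le> (M * s)\<^sup>2" using A_bound[of x] abs_le_square_iff[of "A x" "M * s"] by simp
      also have "1 + A x + (M * s)\<^sup>2 \<le>
          (1 + M\<^sup>2 * s\<^sup>2 + k2 * N * s\<^sup>2 - K' * \<epsilon> * s) + s * \<delta> s * (Q t x - c) - \<kappa> * s * (w x / s)"
        using dw[of x] s unfolding A_eq by (simp add: power_mult_distrib)
      finally have "exp (A x) * exp (\<kappa> * Q t x) \<le> ((1 + M\<^sup>2 * s\<^sup>2 + k2 * N * s\<^sup>2 - K' * \<epsilon> * s)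
          + s * \<delta> s * (Q t x - c) - \<kappa> * s * (w x / s)) * exp (\<kappa> * Q t x)"
        by (simp add: mult_right_mono)
      then show ?thesis using s by (simp add: algebra_simps)
    qed
    have intcU: "integrable \<mu> (\<lambda>x. (Q t x - c) * exp (\<kappa> * Q t x))"
      unfolding left_diff_distrib using intqU intU by auto
    have A_meas: "(\<lambda>x. A x + \<kappa> * Q t x) \<in> borel_measurable \<mu>" unfolding A_def by measurable
    have "(\<integral>x. exp (A x) * exp (\<kappa> * Q t x) \<partial>\<mu>) \<le>
        (\<integral>x. (1 + M\<^sup>2 * s\<^sup>2 + k2 * N * s\<^sup>2 - K' * \<epsilon> * s) * exp (\<kappa> * Q t x)
        + s * \<delta> s * ((Q t x - c) * exp (\<kappa> * Q t x)) - \<kappa> * s * (w x / s * exp (\<kappa> * Q t x)) \<partial>\<mu>)"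
    proof (rule integral_mono)
      have "\<bar>A x + \<kappa> * Q t x\<bar> \<le> M * s + \<kappa> * B" for x
        using A_bound[of x] kQ_bound[of x] by linarith
      then have "integrable \<mu> (\<lambda>x. exp (A x + \<kappa> * Q t x))"
        by (rule integrable_exp[OF A_meas])
      then show "integrable \<mu> (\<lambda>x. exp (A x) * exp (\<kappa> * Q t x))" by (simp add: exp_add)
      show "integrable \<mu> (\<lambda>x. (1 + M\<^sup>2 * s\<^sup>2 + k2 * N * s\<^sup>2 - K' * \<epsilon> * s) * exp (\<kappa> * Q t x)
        + s * \<delta> s * ((Q t x - c) * exp (\<kappa> * Q t x)) - \<kappa> * s * (w x / s * exp (\<kappa> * Q t x)))"
        by (intro Bochner_Integration.integrable_diff Bochner_Integration.integrable_add
            integrable_mult_right intU intcU intwU)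
    qed (rule exp_A)
    also have "\<dots> = (1 + M\<^sup>2 * s\<^sup>2 + k2 * N * s\<^sup>2 - K' * \<epsilon> * s) * Z + s * \<delta> s * (E / \<kappa>) - \<kappa> * s * I"
      unfolding I_def Z_def E_eq[symmetric]
      by (simp add: intU intcU intwU del: times_divide_eq_left times_divide_eq_right)
    also have "\<dots> \<le> (1 + M\<^sup>2 * s\<^sup>2 + k2 * N * s\<^sup>2 - K' * \<epsilon> * s) * Z + s * \<delta> s * (E / \<kappa>)
        - \<kappa> * s * (E / (C * m) - \<eta>)"
      using mult_left_mono[OF I, of "\<kappa> * s"] s \<kappa>_pos by simp
    also have "\<dots> = Z + s * L s"
      by (simp only: L_def K'_def power2_eq_square) (simp add: algebra_simps)
    also have "\<dots> < Z" using elim s by (simp add: mult_pos_neg)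
    finally have G: "(\<integral>x. exp (A x) * exp (\<kappa> * Q t x) \<partial>\<mu>) < Z" .
    have "exp (A x) * exp (\<kappa> * Q t x) = exp (\<kappa> * c - K' * (c + \<epsilon> * s)) * exp (K' * Q (t + s) x)" for x
      by (simp add: A_def algebra_simps flip: exp_add)
    then have "exp (\<kappa> * c - K' * (c + \<epsilon> * s)) * (\<integral>x. exp (K' * Q (t + s) x) \<partial>\<mu>) < Z"
      using G by simp
    also have "Z = exp (\<kappa> * c - K' * (c + \<epsilon> * s)) * exp (K' * (c + \<epsilon> * s))"
      using Z \<kappa>c by (simp flip: exp_add)
    finally have lt: "(\<integral>x. exp (K' * Q (t + s) x) \<partial>\<mu>) < exp (K' * (c + \<epsilon> * s))" by simp
    have "(\<integral>x. exp (K' * Q (t + s) x) \<partial>\<mu>) > 0"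
      by (rule integral_exp_pos[where b = "K' * B"]) (use scaled_flow_bound[OF ts] K'_pos in auto)
    then have "ln (\<integral>x. exp (K' * Q (t + s) x) \<partial>\<mu>) \<le> K' * (c + \<epsilon> * s)"
      using lt by (smt (verit) exp_gt_zero ln_exp ln_le_cancel_iff)
    then have "H K' (t + s) \<le> c + \<epsilon> * s" using K'_pos by (simp add: H_def divide_le_eq mult.commute)
    then show ?case by (simp add: K'_eq H_def c_def Z_def \<kappa>_def)
  qed
qed

end

section \<open>Dependence of the norms on the exponent, and the limit at time 0\<close>

context prob_space
begin

lemma Lk_norm_exp:
  fixes g :: "'a \<Rightarrow> real"
  assumes [measurable]: "g \<in> borel_measurable M" and b: "\<And>x. \<bar>g x\<bar> \<le> b" and "\<kappa> \<noteq> 0"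
  shows "Lk_norm M \<kappa> (\<lambda>x. exp (g x)) = exp (ln (\<integral>x. exp (\<kappa> * g x) \<partial>M) / \<kappa>)"
proof -
  have "(\<integral>x. exp (\<kappa> * g x) \<partial>M) > 0"
    by (rule integral_exp_pos[where b = "\<bar>\<kappa>\<bar> * b"]) (use b in \<open>auto simp: abs_mult mult_left_mono\<close>)
  then show ?thesis using \<open>\<kappa> \<noteq> 0\<close> by (simp add: Lk_norm_def powr_def)
qed

lemma ln_integral_exp_abs_le:
  fixes g :: "'a \<Rightarrow> real"
  assumes g: "g \<in> borel_measurable M" and b: "\<And>x. \<bar>g x\<bar> \<le> b"
  shows "\<bar>ln (\<integral>x. exp (g x) \<partial>M)\<bar> \<le> b"
proof -
  let ?Z = "\<integral>x. exp (g x) \<partial>M"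
  have pos: "?Z > 0" by (rule integral_exp_pos[OF g b])
  have "?Z \<le> (\<integral>x. exp b \<partial>M)"
    by (rule integral_mono[OF integrable_exp[OF g b]]) (use b abs_le_D1 in auto)
  then have "?Z \<le> exp b" by (simp add: prob_space)
  moreover have "(\<integral>x. exp (-b) \<partial>M) \<le> ?Z"
  proof (rule integral_mono[OF _ integrable_exp[OF g b]])
    show "exp (-b) \<le> exp (g x)" for x using b[of x] by simp
  qed simp_all
  then have "exp (-b) \<le> ?Z" by (simp add: prob_space)
  ultimately have "ln ?Z \<le> ln (exp b)" "ln (exp (-b)) \<le> ln ?Z"
    using pos by (simp_all only: ln_le_cancel_iff exp_gt_zero)
  then show ?thesis by simp
qed

end

text \<open>While its base is positive, this solves
  \<open>k' * C * k powr (P / (P - 1)) = k\<^sup>2\<close> with value 1 at \<open>t\<^sub>0\<close>.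
  The branches of \<open>k_exponent\<close> are the cases \<open>P = p\<close> and
  \<open>P = r\<close>.\<close>

definition hyper_exponent :: "real \<Rightarrow> real \<Rightarrow> real \<Rightarrow> real \<Rightarrow> real" where
  "hyper_exponent C P t\<^sub>0 t = (1 + inverse C * (t - t\<^sub>0) / (P - 1)) powr (P - 1)"

lemma hyper_exponent_self [simp]: "hyper_exponent C P t t = 1"
  by (simp add: hyper_exponent_def)

lemma hyper_exponent_le_one:
  assumes "C > 0" "P > 1" "t \<le> t\<^sub>0" "t\<^sub>0 - t \<le> C * (P - 1)"
  shows "hyper_exponent C P t\<^sub>0 t \<le> 1"
proof -
  have "inverse C * (t - t\<^sub>0) / (P - 1) \<le> 0" using assms by (simp add: divide_le_0_iff mult_le_0_iff)
  moreover have "inverse C * (t - t\<^sub>0) / (P - 1) \<ge> -1" using assms by (simp add: field_simps)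
  ultimately show ?thesis unfolding hyper_exponent_def
    using assms powr_mono2[of "P - 1" "1 + inverse C * (t - t\<^sub>0) / (P - 1)" 1] by simp
qed

lemma hyper_exponent_ge_one:
  assumes "C > 0" "P > 1" "t \<ge> t\<^sub>0"
  shows "hyper_exponent C P t\<^sub>0 t \<ge> 1"
  using assms by (simp add: hyper_exponent_def ge_one_powr_ge_zero)

lemma hyper_exponent_deriv:
  assumes C: "C > 0" and P: "P > 1" and base: "1 + inverse C * (t - t\<^sub>0) / (P - 1) > 0"
  defines "k1 \<equiv> inverse C * (1 + inverse C * (t - t\<^sub>0) / (P - 1)) powr (P - 2)"
  shows "(hyper_exponent C P t\<^sub>0 has_real_derivative k1) (at t)"
    and "k1 * C * hyper_exponent C P t\<^sub>0 t powr (P / (P - 1)) = (hyper_exponent C P t\<^sub>0 t)\<^sup>2"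
proof -
  let ?b = "\<lambda>t. 1 + inverse C * (t - t\<^sub>0) / (P - 1)"
  have "(?b has_real_derivative inverse C / (P - 1)) (at t)"
    using P by (auto intro!: derivative_eq_intros)
  from DERIV_fun_powr[OF this base, of "P - 1"]
  show "(hyper_exponent C P t\<^sub>0 has_real_derivative k1) (at t)"
    unfolding hyper_exponent_def[abs_def] k1_def using P by (simp add: mult.commute)
  have "k1 * C * hyper_exponent C P t\<^sub>0 t powr (P / (P - 1)) = ?b t powr (P - 2) * ?b t powr P"
    using C P by (simp add: k1_def hyper_exponent_def powr_powr)
  also have "\<dots> = ?b t powr (P - 1) * ?b t powr (P - 1)"
    by (simp flip: powr_add)
  finally show "k1 * C * hyper_exponent C P t\<^sub>0 t powr (P / (P - 1)) = (hyper_exponent C P t\<^sub>0 t)\<^sup>2"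
    by (simp add: hyper_exponent_def power2_eq_square)
qed

context hopf_lax_measure
begin

lemma measurable_initial: "f \<in> borel_measurable \<mu>"
  by (rule measurable_of_continuous[OF cont])

lemma scaled_initial_bound: "\<kappa> \<ge> 0 \<Longrightarrow> \<bar>\<kappa> * f x\<bar> \<le> \<kappa> * B"
  using bound[of x] by (simp add: abs_mult mult_left_mono)

lemma H_abs_le:
  assumes t: "t > 0" and \<kappa>: "\<kappa> > 0"
  shows "\<bar>H \<kappa> t\<bar> \<le> B"
proof -
  note [measurable] = measurable_flow[OF t]
  have "\<bar>ln (\<integral>x. exp (\<kappa> * Q t x) \<partial>\<mu>)\<bar> \<le> \<kappa> * B"
    by (rule ln_integral_exp_abs_le) (use scaled_flow_bound[OF t] \<kappa> in auto)
  then show ?thesis using \<kappa> by (simp add: H_def divide_le_eq mult.commute)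
qed

text \<open>Replacing \<kappa> by \<open>\<kappa>'\<close> is paid for twice, in the integrand and
  in the dividing factor, each time with at most
  \<open>B * \<bar>\<kappa>' - \<kappa>\<bar>\<close>. For a continuous exponent this yields the
  left-hand condition of \<open>right_dini_nonincreasing\<close>.\<close>

lemma H_le_earlier:
  assumes t: "0 < s" "s \<le> t" and \<kappa>: "\<kappa> > 0" "\<kappa>' > 0"
  shows "H \<kappa>' t \<le> H \<kappa> s + 2 * B * \<bar>\<kappa>' - \<kappa>\<bar> / \<kappa>'"
proof -
  have t0: "t > 0" using t by simp
  note [measurable] = measurable_flow[OF t0] measurable_flow[OF t(1)]
  have int: "integrable \<mu> (\<lambda>x. exp (\<kappa> * Q s x))" if "s > 0" "\<kappa> > 0" for \<kappa> s
    by (rule integrable_exp[where b = "\<kappa> * B"]) (use that measurable_flow scaled_flow_bound in auto)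
  have pos: "(\<integral>x. exp (\<kappa> * Q s x) \<partial>\<mu>) > 0" if "s > 0" "\<kappa> > 0" for \<kappa> s
    by (rule integral_exp_pos[where b = "\<kappa> * B"]) (use that measurable_flow scaled_flow_bound in auto)
  have "(\<integral>x. exp (\<kappa>' * Q t x) \<partial>\<mu>) \<le> (\<integral>x. exp (\<kappa>' * Q s x) \<partial>\<mu>)"
    by (intro integral_mono int) (use t \<kappa> flow_antimono[OF t] in auto)
  also have "\<dots> \<le> exp (\<bar>\<kappa>' - \<kappa>\<bar> * B) * (\<integral>x. exp (\<kappa> * Q s x) \<partial>\<mu>)"
    by (rule integral_exp_scale_le) (use t flow_bound in auto)
  finally have "ln (\<integral>x. exp (\<kappa>' * Q t x) \<partial>\<mu>) \<le> ln (exp (\<bar>\<kappa>' - \<kappa>\<bar> * B) * (\<integral>x. exp (\<kappa> * Q s x) \<partial>\<mu>))"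
    using pos[OF t0 \<kappa>(2)] by (subst ln_le_cancel_iff) auto
  also have "\<dots> = \<bar>\<kappa>' - \<kappa>\<bar> * B + ln (\<integral>x. exp (\<kappa> * Q s x) \<partial>\<mu>)"
    using pos[OF t(1) \<kappa>(1)] by (subst ln_mult) auto
  finally have "\<kappa>' * H \<kappa>' t \<le> \<bar>\<kappa>' - \<kappa>\<bar> * B + \<kappa> * H \<kappa> s" using \<kappa> by (simp add: H_def)
  also have "\<kappa> * H \<kappa> s \<le> \<kappa>' * H \<kappa> s + \<bar>\<kappa>' - \<kappa>\<bar> * B"
  proof -
    have "\<bar>(\<kappa> - \<kappa>') * H \<kappa> s\<bar> \<le> \<bar>\<kappa>' - \<kappa>\<bar> * B"
      unfolding abs_mult using H_abs_le[OF t(1) \<kappa>(1)] by (intro mult_mono) auto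
    then show ?thesis by (simp add: left_diff_distrib abs_le_iff)
  qed
  finally have "\<kappa>' * H \<kappa>' t \<le> \<kappa>' * (H \<kappa> s + 2 * B * \<bar>\<kappa>' - \<kappa>\<bar> / \<kappa>')"
    using \<kappa> by (simp add: algebra_simps)
  then show ?thesis using \<kappa> by simp
qed

lemma H_antimono: "0 < s \<Longrightarrow> s \<le> t \<Longrightarrow> \<kappa> > 0 \<Longrightarrow> H \<kappa> t \<le> H \<kappa> s"
  using H_le_earlier[of s t \<kappa> \<kappa>] by simp

lemma H_le_initial:
  assumes t: "t > 0" and \<kappa>: "\<kappa> > 0"
  shows "H \<kappa> t \<le> ln (\<integral>x. exp (\<kappa> * f x) \<partial>\<mu>) / \<kappa>"
proof -
  note [measurable] = measurable_flow[OF t] measurable_initial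
  have "(\<integral>x. exp (\<kappa> * Q t x) \<partial>\<mu>) \<le> (\<integral>x. exp (\<kappa> * f x) \<partial>\<mu>)"
  proof (intro integral_mono)
    show "integrable \<mu> (\<lambda>x. exp (\<kappa> * Q t x))"
      by (rule integrable_exp[where b = "\<kappa> * B"]) (use t \<kappa> scaled_flow_bound in auto)
    show "integrable \<mu> (\<lambda>x. exp (\<kappa> * f x))"
      by (rule integrable_exp[where b = "\<kappa> * B"]) (use \<kappa> scaled_initial_bound in auto)
  qed (use flow_le_self[OF t] \<kappa> in auto)
  moreover have "(\<integral>x. exp (\<kappa> * Q t x) \<partial>\<mu>) > 0"
    by (rule integral_exp_pos[where b = "\<kappa> * B"]) (use t \<kappa> scaled_flow_bound in auto)
  ultimately show ?thesis using \<kappa> by (simp add: H_def divide_right_mono)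
qed

text \<open>As the flow stays below \<open>f\<close>, every small \<open>a\<close> bounds
  \<open>X\<close> by a norm of \<open>exp (f x)\<close> with exponent \<open>K a\<close>, so only
  the exponent has to converge. The limit 0 occurs when \<open>t\<^sub>0 = C * (p - 1)\<close>;
  there a second-order expansion produces the logarithmic norm.\<close>

lemma le_initial_norm:
  assumes t: "t > 0" and le: "\<And>a. 0 < a \<Longrightarrow> a < t \<Longrightarrow> X \<le> H (K a) a"
    and K_pos: "\<And>a. 0 < a \<Longrightarrow> a < t \<Longrightarrow> K a > 0"
    and K: "(K \<longlongrightarrow> \<kappa>) (at_right 0)" and \<kappa>: "\<kappa> \<ge> 0"
  shows "exp X \<le> Lk_norm \<mu> \<kappa> (\<lambda>x. exp (f x))"
proof -
  note [measurable] = measurable_initial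
  have int: "integrable \<mu> (\<lambda>x. exp (\<kappa> * f x))" if "\<kappa> > 0" for \<kappa>
    by (rule integrable_exp[where b = "\<kappa> * B"]) (use that scaled_initial_bound in auto)
  have pos: "(\<integral>x. exp (\<kappa> * f x) \<partial>\<mu>) > 0" if "\<kappa> > 0" for \<kappa>
    by (rule integral_exp_pos[where b = "\<kappa> * B"]) (use that scaled_initial_bound in auto)
  have ev: "eventually (\<lambda>a. 0 < a \<and> a < t) (at_right 0)"
    by (auto simp: eventually_at_right[OF t] intro: exI[of _ t] t)
  have le0: "X \<le> ln (\<integral>x. exp (K a * f x) \<partial>\<mu>) / K a" if "0 < a" "a < t" for a
    using le[OF that] H_le_initial[OF that(1) K_pos[OF that]] by linarith
  show ?thesis
  proof (cases "\<kappa> = 0")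
    case True
    have lim: "((\<lambda>a. (\<integral>x. f x \<partial>\<mu>) + K a * B\<^sup>2) \<longlongrightarrow> (\<integral>x. f x \<partial>\<mu>) + \<kappa> * B\<^sup>2) (at_right 0)"
      by (intro tendsto_intros K)
    have "((\<lambda>a. K a * B) \<longlongrightarrow> \<kappa> * B) (at_right 0)" by (intro tendsto_intros K)
    then have "eventually (\<lambda>a. K a * B < 1) (at_right 0)"
      by (rule order_tendstoD) (use True in simp)
    then have "eventually (\<lambda>a. X \<le> (\<integral>x. f x \<partial>\<mu>) + K a * B\<^sup>2) (at_right 0)"
      using ev
    proof eventually_elim
      case (elim a)
      let ?k = "K a"
      have k: "?k > 0" using elim K_pos by simp
      have intf: "integrable \<mu> f" by (rule integrable_of_abs_bound[OF _ bound]) simp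
      have "(\<integral>x. exp (?k * f x) \<partial>\<mu>) \<le> (\<integral>x. 1 + ?k * f x + ?k\<^sup>2 * B\<^sup>2 \<partial>\<mu>)"
      proof (rule integral_mono[OF int[OF k]])
        fix x
        have "\<bar>?k * f x\<bar> \<le> ?k * B" using scaled_initial_bound[of ?k] k by simp
        then have "exp (?k * f x) \<le> 1 + ?k * f x + (?k * f x)\<^sup>2"
          using elim by (intro exp_le_one_plus_square) simp
        also have "(?k * f x)\<^sup>2 \<le> (?k * B)\<^sup>2"
          using \<open>\<bar>?k * f x\<bar> \<le> ?k * B\<close> abs_le_square_iff[of "?k * f x" "?k * B"] by simp
        finally show "exp (?k * f x) \<le> 1 + ?k * f x + ?k\<^sup>2 * B\<^sup>2" by (simp add: power_mult_distrib)
      qed (use intf in simp)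
      also have "\<dots> = 1 + ?k * (\<integral>x. f x \<partial>\<mu>) + ?k\<^sup>2 * B\<^sup>2" using intf by (simp add: prob_space)
      finally have "ln (\<integral>x. exp (?k * f x) \<partial>\<mu>) \<le> ?k * (\<integral>x. f x \<partial>\<mu>) + ?k\<^sup>2 * B\<^sup>2"
        using ln_le_minus_one[OF pos[OF k]] by linarith
      also have "\<dots> = ((\<integral>x. f x \<partial>\<mu>) + ?k * B\<^sup>2) * ?k" by (simp add: power2_eq_square algebra_simps)
      finally have "ln (\<integral>x. exp (?k * f x) \<partial>\<mu>) / ?k \<le> (\<integral>x. f x \<partial>\<mu>) + ?k * B\<^sup>2"
        using k by (simp add: pos_divide_le_eq)
      then show ?case using le0[of a] elim by simp
    qed
    then have "X \<le> (\<integral>x. f x \<partial>\<mu>) + \<kappa> * B\<^sup>2" by (rule tendsto_lowerbound[OF lim]) simp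
    then show ?thesis using True by (simp add: Lk_norm_def)
  next
    case False
    then have \<kappa>_pos: "\<kappa> > 0" using \<kappa> by simp
    let ?l = "ln (\<integral>x. exp (\<kappa> * f x) \<partial>\<mu>)"
    have lim: "((\<lambda>a. (\<bar>K a - \<kappa>\<bar> * B + ?l) / K a) \<longlongrightarrow> (\<bar>\<kappa> - \<kappa>\<bar> * B + ?l) / \<kappa>) (at_right 0)"
      by (intro tendsto_intros K) (use False in simp)
    have "eventually (\<lambda>a. X \<le> (\<bar>K a - \<kappa>\<bar> * B + ?l) / K a) (at_right 0)"
      using ev
    proof eventually_elim
      case (elim a)
      then have k: "K a > 0" using K_pos by simp
      have "(\<integral>x. exp (K a * f x) \<partial>\<mu>) \<le> exp (\<bar>K a - \<kappa>\<bar> * B) * (\<integral>x. exp (\<kappa> * f x) \<partial>\<mu>)"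
        by (rule integral_exp_scale_le) (use bound in auto)
      then have "ln (\<integral>x. exp (K a * f x) \<partial>\<mu>) \<le> ln (exp (\<bar>K a - \<kappa>\<bar> * B) * (\<integral>x. exp (\<kappa> * f x) \<partial>\<mu>))"
        using pos[OF k] by (subst ln_le_cancel_iff) auto
      also have "\<dots> = \<bar>K a - \<kappa>\<bar> * B + ?l" using pos[OF \<kappa>_pos] by (subst ln_mult) auto
      finally have "ln (\<integral>x. exp (K a * f x) \<partial>\<mu>) / K a \<le> (\<bar>K a - \<kappa>\<bar> * B + ?l) / K a"
        using k by (simp add: divide_right_mono)
      then show ?case using le0[of a] elim by simp
    qed
    then have "X \<le> (\<bar>\<kappa> - \<kappa>\<bar> * B + ?l) / \<kappa>" by (rule tendsto_lowerbound[OF lim]) simp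
    then show ?thesis using Lk_norm_exp[OF measurable_initial bound False] by simp
  qed
qed

text \<open>A single growth bound rules on each side of \<open>t\<^sub>0\<close>: before it the
  exponent is at most 1, after it at least 1, which matches the two cases of
  \<open>conjugate_scale_le\<close>. The strict inequality \<open>base\<close> keeps the exponent
  positive, which fails at time 0 when \<open>t\<^sub>0 = C * (P - 1)\<close>.\<close>

lemma H_segment:
  assumes LSI: "LSI_minus \<alpha> C \<mu>" and C: "C > 0" and P: "P > 1" and ab: "0 < a" "a \<le> b"
    and base: "a - t\<^sub>0 > - (C * (P - 1))"
    and growth: "(b \<le> t\<^sub>0 \<and> (\<forall>x>0. x * \<alpha>' x \<le> P * \<alpha> x)) \<or> (t\<^sub>0 \<le> a \<and> (\<forall>x>0. P * \<alpha> x \<le> x * \<alpha>' x))"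
  shows "H (hyper_exponent C P t\<^sub>0 b) b \<le> H (hyper_exponent C P t\<^sub>0 a) a"
proof -
  let ?K = "hyper_exponent C P t\<^sub>0"
  have b_pos: "1 + inverse C * (\<tau> - t\<^sub>0) / (P - 1) > 0" if "\<tau> \<ge> a" for \<tau>
    using base that C P by (simp add: field_simps)
  have K_pos: "?K \<tau> > 0" if "\<tau> \<ge> a" for \<tau>
    using b_pos[OF that] by (simp add: hyper_exponent_def)
  show ?thesis
  proof (rule right_dini_nonincreasing[where H = "\<lambda>\<tau>. H (?K \<tau>) \<tau>", OF ab(2)])
    fix \<tau> \<epsilon> :: real assume \<tau>: "a \<le> \<tau>" "\<tau> < b" and \<epsilon>: "\<epsilon> > 0"
    have t: "\<tau> > 0" using \<tau> ab by simp
    have growth': "(?K \<tau> \<le> 1 \<and> (\<forall>x>0. x * \<alpha>' x \<le> P * \<alpha> x)) \<or> (?K \<tau> \<ge> 1 \<and> (\<forall>x>0. P * \<alpha> x \<le> x * \<alpha>' x))"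
      using growth
    proof
      assume *: "b \<le> t\<^sub>0 \<and> (\<forall>x>0. x * \<alpha>' x \<le> P * \<alpha> x)"
      have "?K \<tau> \<le> 1" using * \<tau> base by (intro hyper_exponent_le_one C P) auto
      then show ?thesis using * by simp
    next
      assume *: "t\<^sub>0 \<le> a \<and> (\<forall>x>0. P * \<alpha> x \<le> x * \<alpha>' x)"
      have "?K \<tau> \<ge> 1" using * \<tau> by (intro hyper_exponent_ge_one C P) auto
      then show ?thesis using * by simp
    qed
    show "eventually (\<lambda>s. H (?K (\<tau> + s)) (\<tau> + s) \<le> H (?K \<tau>) \<tau> + \<epsilon> * s) (at_right 0)"
    proof (rule H_right_dini[where K = ?K, OF LSI C t K_pos[OF \<tau>(1)]])
      show "?K \<tau> powr (P / (P - 1)) > 0" using K_pos[OF \<tau>(1)] by simp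
      show "g * (?K \<tau> * \<alpha>' h) - \<alpha> g \<le> ?K \<tau> powr (P / (P - 1)) * \<beta> h" if "g \<ge> 0" "h \<ge> 0" for g h
        by (rule conjugate_scale_le[OF K_pos[OF \<tau>(1)] P that growth'])
      show "(\<lambda>x. ?K \<tau> * Q \<tau> x) \<in> F_class \<alpha>"
        by (rule scaled_flow_in_F_class[OF t K_pos[OF \<tau>(1)]])
          (use growth' Lim_ratio_eq_top[OF P] in blast)
      have "((\<lambda>s. (?K (\<tau> + s) - ?K \<tau>) / s) \<longlongrightarrow> inverse C * (1 + inverse C * (\<tau> - t\<^sub>0) / (P - 1)) powr (P - 2)) (at 0)"
        using hyper_exponent_deriv(1)[OF C P b_pos[OF \<tau>(1)]] by (simp add: DERIV_def)
      then show "((\<lambda>s. (?K (\<tau> + s) - ?K \<tau>) / s) \<longlongrightarrow> inverse C * (1 + inverse C * (\<tau> - t\<^sub>0) / (P - 1)) powr (P - 2)) (at_right 0)"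
        by (rule tendsto_within_subset) simp
    qed (fact hyper_exponent_deriv(2)[OF C P b_pos[OF \<tau>(1)]] \<epsilon>)+
  next
    fix \<tau> e :: real assume \<tau>: "a < \<tau>" "\<tau> \<le> b" and e: "e > 0"
    have "isCont ?K \<tau>" using hyper_exponent_deriv(1)[OF C P b_pos] \<tau> DERIV_isCont by (metis less_imp_le)
    then have K_lim: "(?K \<longlongrightarrow> ?K \<tau>) (at_left \<tau>)"
      unfolding isCont_def by (rule tendsto_within_subset) simp
    have "((\<lambda>\<sigma>. 2 * B * \<bar>?K \<tau> - ?K \<sigma>\<bar> / ?K \<tau>) \<longlongrightarrow> 2 * B * \<bar>?K \<tau> - ?K \<tau>\<bar> / ?K \<tau>) (at_left \<tau>)"
      using K_pos[of \<tau>] \<tau> by (intro tendsto_intros K_lim) auto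
    then have "eventually (\<lambda>\<sigma>. 2 * B * \<bar>?K \<tau> - ?K \<sigma>\<bar> / ?K \<tau> < e) (at_left \<tau>)"
      by (rule order_tendstoD) (use e in simp)
    moreover have "eventually (\<lambda>\<sigma>. a < \<sigma> \<and> \<sigma> < \<tau>) (at_left \<tau>)"
      using \<tau> by (auto simp: eventually_at_left[of a])
    ultimately show "eventually (\<lambda>\<sigma>. H (?K \<tau>) \<tau> \<le> H (?K \<sigma>) \<sigma> + e) (at_left \<tau>)"
    proof eventually_elim
      case (elim \<sigma>)
      have "H (?K \<tau>) \<tau> \<le> H (?K \<sigma>) \<sigma> + 2 * B * \<bar>?K \<tau> - ?K \<sigma>\<bar> / ?K \<tau>"
        using elim ab \<tau> by (intro H_le_earlier K_pos) auto
      then show ?case using elim by simp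
    qed
  qed
qed

text \<open>If \<open>t\<^sub>0 = C * (P - 1)\<close>, the base vanishes at time 0. Convergence of
  the power then rests on \<open>P - 1 > 0\<close> and on a base that is nonnegative to the right of
  0.\<close>

lemma hyper_exponent_tendsto:
  assumes C: "C > 0" and P: "P > 1" and "t\<^sub>0 \<le> C * (P - 1)"
  shows "(hyper_exponent C P t\<^sub>0 \<longlongrightarrow> hyper_exponent C P t\<^sub>0 0) (at_right 0)"
  unfolding hyper_exponent_def[abs_def]
proof (rule tendsto_powr')
  show "((\<lambda>t. 1 + inverse C * (t - t\<^sub>0) / (P - 1)) \<longlongrightarrow> 1 + inverse C * (0 - t\<^sub>0) / (P - 1)) (at_right 0)"
    using P by (intro tendsto_intros) auto
  have "1 + inverse C * (t - t\<^sub>0) / (P - 1) \<ge> 0" if "t > 0" for t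
    using that assms by (simp add: field_simps)
  then have "eventually (\<lambda>t. 1 + inverse C * (t - t\<^sub>0) / (P - 1) \<ge> 0) (at_right 0)"
    by (auto simp: eventually_at_filter)
  then show "1 + inverse C * (0 - t\<^sub>0) / (P - 1) \<noteq> 0 \<or> 0 < P - 1 \<and>
      eventually (\<lambda>t. 1 + inverse C * (t - t\<^sub>0) / (P - 1) \<ge> 0) (at_right 0)"
    using P by simp
qed simp

text \<open>Two segments are joined at \<open>t\<^sub>0\<close>, where the exponent is 1 and the
  growth bound in force changes from \<open>p\<close> to \<open>r\<close>. If \<open>r > 1\<close>
  fails, the exponent stays at 1 afterwards and the decrease of the flow in time is enough. If
  \<open>t\<^sub>0 \<le> 0\<close>, only the second regime occurs.\<close>

lemma hypercontractive:
  assumes LSI: "LSI_minus \<alpha> C \<mu>" and C: "C > 0" and p: "p > 1"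
    and upper: "\<And>x. x > 0 \<Longrightarrow> x * \<alpha>' x \<le> p * \<alpha> x"
    and lower: "\<And>x. x > 0 \<Longrightarrow> r * \<alpha> x \<le> x * \<alpha>' x"
    and t: "t > 0" and t0: "t\<^sub>0 \<le> C * (p - 1)"
  shows "Lk_norm \<mu> (k_exponent C r p t\<^sub>0 t) (\<lambda>x. exp (hopf_lax \<alpha> t f x))
    \<le> Lk_norm \<mu> (k_exponent C r p t\<^sub>0 0) (\<lambda>x. exp (f x))"
proof -
  let ?k = "k_exponent C r p t\<^sub>0"
  let ?Kp = "hyper_exponent C p t\<^sub>0" and ?Kr = "hyper_exponent C r t\<^sub>0"
  have k_before: "?k \<tau> = ?Kp \<tau>" if "0 \<le> \<tau>" "\<tau> \<le> t\<^sub>0" for \<tau>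
    using hyper_exponent_le_one[OF C p that(2)] that t0 by (auto simp: k_exponent_def hyper_exponent_def)
  have k_after_r: "?k \<tau> = ?Kr \<tau>" if "r > 1" "\<tau> > t\<^sub>0" for \<tau>
    using that by (simp add: k_exponent_def hyper_exponent_def)
  have k_after_1: "?k \<tau> = 1" if "\<not> r > 1" "\<tau> > t\<^sub>0" for \<tau>
    using that hyper_exponent_ge_one[OF C p, of t\<^sub>0 \<tau>] by (simp add: k_exponent_def hyper_exponent_def)
  have before: "exp (H (?Kp s) s) \<le> Lk_norm \<mu> (?Kp 0) (\<lambda>x. exp (f x))" if s: "0 < s" "s \<le> t\<^sub>0" for s
  proof (rule le_initial_norm[OF s(1)])
    fix a assume a: "0 < a" "a < s"
    have "a - t\<^sub>0 > - (C * (p - 1))" using a t0 by simp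
    then show "H (?Kp s) s \<le> H (?Kp a) a"
      using a s upper by (intro H_segment[OF LSI C p]) auto
    have "1 + inverse C * (a - t\<^sub>0) / (p - 1) > 0" using a t0 C p by (simp add: field_simps)
    then show "?Kp a > 0" by (simp add: hyper_exponent_def)
  next
    show "?Kp 0 \<ge> 0" by (simp add: hyper_exponent_def)
  qed (rule hyper_exponent_tendsto[OF C p t0])
  have after: "H (?k t) t \<le> H 1 s" if "0 < s" "s \<le> t" "t\<^sub>0 = s" "t\<^sub>0 < t" for s
  proof (cases "r > 1")
    case True
    have "H (?Kr t) t \<le> H (?Kr s) s"
      using that lower C True by (intro H_segment[OF LSI C True]) auto
    then show ?thesis using k_after_r[OF True that(4)] that by simp
  next
    case False
    then show ?thesis using k_after_1[OF False that(4)] H_antimono[of s t 1] that by simp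
  qed
  have k_nonneg: "?k \<tau> \<ge> 0" for \<tau> by (simp add: k_exponent_def)
  \<comment> \<open>\<open>Lk_norm\<close> has a separate value at exponent 0. That value can occur
    at time 0, but not at \<open>t > 0\<close>, so the left norm is the exponential of
    \<open>H\<close>.\<close>
  have "?k t \<noteq> 0"
  proof (cases "t \<le> t\<^sub>0")
    case True
    have "1 + inverse C * (t - t\<^sub>0) / (p - 1) > 0" using t t0 C p by (simp add: field_simps)
    then show ?thesis using k_before[of t] True t by (simp add: hyper_exponent_def)
  next
    case False
    then show ?thesis
      using k_after_1[of t] k_after_r[of t] hyper_exponent_ge_one[OF C, of r t\<^sub>0 t] by (cases "r > 1") auto
  qed
  then have lhs: "Lk_norm \<mu> (?k t) (\<lambda>x. exp (hopf_lax \<alpha> t f x)) = exp (H (?k t) t)"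
    unfolding H_def by (rule Lk_norm_exp[OF measurable_flow[OF t] flow_bound[OF t]])
  have "exp (H (?k t) t) \<le> Lk_norm \<mu> (?k 0) (\<lambda>x. exp (f x))"
  proof (cases "t \<le> t\<^sub>0")
    case True
    then show ?thesis using before[of t] t k_before[of t] k_before[of 0] by simp
  next
    case False
    show ?thesis
    proof (cases "t\<^sub>0 > 0")
      case True
      have "H (?k t) t \<le> H (?Kp t\<^sub>0) t\<^sub>0" using after[of t\<^sub>0] True False by simp
      then have "exp (H (?k t) t) \<le> exp (H (?Kp t\<^sub>0) t\<^sub>0)" by simp
      also have "\<dots> \<le> Lk_norm \<mu> (?Kp 0) (\<lambda>x. exp (f x))" using before[of t\<^sub>0] True by simp
      finally show ?thesis using k_before[of 0] True by simp
    next
      case neg: False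
      show ?thesis
      proof (cases "r > 1")
        case True
        have k0: "?k 0 = ?Kr 0"
          using k_after_r[OF True, of 0] k_before[of 0] neg by (cases "t\<^sub>0 = 0") auto
        have "exp (H (?Kr t) t) \<le> Lk_norm \<mu> (?Kr 0) (\<lambda>x. exp (f x))"
        proof (rule le_initial_norm[OF t])
          fix a assume a: "0 < a" "a < t"
          have "0 < C * (r - 1)" using C True by simp
          then have "a - t\<^sub>0 > - (C * (r - 1))" using a neg by linarith
          then show "H (?Kr t) t \<le> H (?Kr a) a"
            using a neg lower by (intro H_segment[OF LSI C True]) auto
          show "?Kr a > 0" using hyper_exponent_ge_one[OF C True, of t\<^sub>0 a] a neg by simp
        next
          have "0 \<le> C * (r - 1)" using C True by simp
          then show "(?Kr \<longlongrightarrow> ?Kr 0) (at_right 0)"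
            using neg by (intro hyper_exponent_tendsto C True) linarith
        qed (simp add: hyper_exponent_def)
        then show ?thesis using k0 k_after_r[OF True, of t] False by simp
      next
        case r1: False
        have k0: "?k 0 = 1" using k_after_1[OF r1, of 0] k_before[of 0] neg by (cases "t\<^sub>0 = 0") auto
        have "exp (H 1 t) \<le> Lk_norm \<mu> 1 (\<lambda>x. exp (f x))"
          by (rule le_initial_norm[OF t, where K = "\<lambda>_. 1"]) (auto intro: H_antimono)
        then show ?thesis using k0 k_after_1[OF r1, of t] False by simp
      qed
    qed
  qed
  then show ?thesis by (simp add: lhs)
qed

end

subsection \<open>From hypercontractivity to the log-Sobolev inequality\<close>

text \<open>Keep the weight \<open>exp (g x)\<close>, expand
  \<open>exp (- (1 - \<kappa>) * g x)\<close> to second order and use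
  \<open>ln (1 + y) \<le> y\<close>. The result is an explicit majorant, exact at
  \<open>\<kappa> = 1\<close>, which can be differentiated in place of the norm.\<close>

lemma (in prob_space) Lk_norm_near_one_le:
  fixes g :: "'a \<Rightarrow> real"
  assumes g [measurable]: "g \<in> borel_measurable M" and b: "\<And>x. \<bar>g x\<bar> \<le> b"
    and \<kappa>: "0 < \<kappa>" "\<kappa> \<le> 1" "(1 - \<kappa>) * b \<le> 1"
  defines "Z \<equiv> \<integral>x. exp (g x) \<partial>M" and "G \<equiv> \<integral>x. g x * exp (g x) \<partial>M"
  shows "Lk_norm M \<kappa> (\<lambda>x. exp (g x)) \<le> exp ((ln Z - (1 - \<kappa>) * (G / Z) + (1 - \<kappa>)\<^sup>2 * b\<^sup>2) / \<kappa>)"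
proof -
  define \<delta> where "\<delta> = 1 - \<kappa>"
  have \<delta>: "\<delta> \<ge> 0" "\<delta> * b \<le> 1" using \<kappa> by (auto simp: \<delta>_def)
  have Z: "Z > 0" unfolding Z_def by (rule integral_exp_pos[OF g b])
  have intZ: "integrable M (\<lambda>x. exp (g x))" by (rule integrable_exp[OF g b])
  have intG: "integrable M (\<lambda>x. g x * exp (g x))" by (rule integrable_mult_exp[OF g g b b])
  have \<kappa>b: "\<bar>\<kappa> * g x\<bar> \<le> \<kappa> * b" for x using \<kappa> b[of x] by (simp add: abs_mult)
  have "(\<integral>x. exp (\<kappa> * g x) \<partial>M) \<le> (\<integral>x. (1 + \<delta>\<^sup>2 * b\<^sup>2) * exp (g x) - \<delta> * (g x * exp (g x)) \<partial>M)"
  proof (rule integral_mono)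
    show "integrable M (\<lambda>x. exp (\<kappa> * g x))" by (rule integrable_exp[OF _ \<kappa>b]) simp
    fix x
    have *: "\<bar>- \<delta> * g x\<bar> \<le> \<delta> * b" using \<delta> b[of x] by (simp add: abs_mult mult_left_mono)
    then have "exp (- \<delta> * g x) \<le> 1 + (- \<delta> * g x) + (- \<delta> * g x)\<^sup>2"
      using \<delta> by (intro exp_le_one_plus_square) linarith
    also have "(- \<delta> * g x)\<^sup>2 \<le> (\<delta> * b)\<^sup>2" using * abs_le_square_iff[of "- \<delta> * g x" "\<delta> * b"] by simp
    finally have "exp (- \<delta> * g x) * exp (g x) \<le> (1 + (- \<delta> * g x) + (\<delta> * b)\<^sup>2) * exp (g x)"
      by (simp add: mult_right_mono)
    moreover have "exp (- \<delta> * g x) * exp (g x) = exp (\<kappa> * g x)"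
      by (simp add: \<delta>_def algebra_simps flip: exp_add)
    ultimately show "exp (\<kappa> * g x) \<le> (1 + \<delta>\<^sup>2 * b\<^sup>2) * exp (g x) - \<delta> * (g x * exp (g x))"
      by (simp add: algebra_simps power_mult_distrib)
  qed (use intZ intG in auto)
  also have "\<dots> = (1 + \<delta>\<^sup>2 * b\<^sup>2) * Z - \<delta> * G"
    using intZ intG by (simp add: Z_def G_def)
  also have "\<dots> = Z * (1 + (\<delta>\<^sup>2 * b\<^sup>2 - \<delta> * (G / Z)))" using Z by (simp add: algebra_simps)
  finally have le: "(\<integral>x. exp (\<kappa> * g x) \<partial>M) \<le> Z * (1 + (\<delta>\<^sup>2 * b\<^sup>2 - \<delta> * (G / Z)))" .
  have pos: "(\<integral>x. exp (\<kappa> * g x) \<partial>M) > 0" by (rule integral_exp_pos[OF _ \<kappa>b]) simp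
  then have pos': "1 + (\<delta>\<^sup>2 * b\<^sup>2 - \<delta> * (G / Z)) > 0"
    using le Z by (metis less_le_trans zero_less_mult_pos)
  have "ln (\<integral>x. exp (\<kappa> * g x) \<partial>M) \<le> ln (Z * (1 + (\<delta>\<^sup>2 * b\<^sup>2 - \<delta> * (G / Z))))"
    using pos le by (subst ln_le_cancel_iff) auto
  also have "\<dots> = ln Z + ln (1 + (\<delta>\<^sup>2 * b\<^sup>2 - \<delta> * (G / Z)))" using Z pos' by (subst ln_mult) auto
  also have "\<dots> \<le> ln Z - \<delta> * (G / Z) + \<delta>\<^sup>2 * b\<^sup>2" using ln_le_minus_one[OF pos'] by linarith
  finally have "ln (\<integral>x. exp (\<kappa> * g x) \<partial>M) / \<kappa> \<le> (ln Z - \<delta> * (G / Z) + \<delta>\<^sup>2 * b\<^sup>2) / \<kappa>"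
    using \<kappa> by (intro divide_right_mono) auto
  then show ?thesis using Lk_norm_exp[OF g b, of \<kappa>] \<kappa> by (simp add: \<delta>_def)
qed

context hopf_lax_measure
begin

text \<open>\<open>h\<close> is the distance to a minimizer divided by \<epsilon>. Beyond
  \<open>h\<^sub>0\<close> the cost outweighs any descent allowed by \<open>M\<close>, the loss is
  nonpositive and \<open>h = 0\<close> serves. Since \<open>h\<close> is fixed before
  \<open>v\<close>, the result applies both with the global Lipschitz constant and with a rate valid
  only near \<open>x\<close>.\<close>

lemma decrement_bound:
  assumes lip: "\<And>x y. f x - f y \<le> M * dist x y" and M: "M \<ge> 0"
    and h0: "h\<^sub>0 > 0" "M * h\<^sub>0 \<le> \<alpha> h\<^sub>0" and \<epsilon>: "\<epsilon> > 0"
  obtains h where "0 \<le> h" "h \<le> h\<^sub>0"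
    "\<And>v. (\<And>y. dist x y \<le> \<epsilon> * h\<^sub>0 \<Longrightarrow> f x - f y \<le> v * dist x y) \<Longrightarrow>
      (f x - Q \<epsilon> x) / \<epsilon> \<le> v * h - \<alpha> h"
proof -
  obtain y where y: "minimizer \<epsilon> x y" using minimizer_exists[OF \<epsilon>] by blast
  define g where "g = dist x y / \<epsilon>"
  have g: "g \<ge> 0" "dist x y = \<epsilon> * g" using \<epsilon> by (auto simp: g_def)
  have eq: "f x - Q \<epsilon> x = f x - f y - \<epsilon> * \<alpha> g" using y by (simp add: minimizer_def g_def)
  show ?thesis
  proof (cases "g \<le> h\<^sub>0")
    case True
    show ?thesis
    proof (rule that[OF g(1) True])
      fix v assume "\<And>y. dist x y \<le> \<epsilon> * h\<^sub>0 \<Longrightarrow> f x - f y \<le> v * dist x y"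
      then have "f x - f y \<le> v * (\<epsilon> * g)" using True \<epsilon> g(2) by (metis mult_le_cancel_left_pos)
      then have "f x - Q \<epsilon> x \<le> (v * g - \<alpha> g) * \<epsilon>" by (simp add: eq algebra_simps)
      then show "(f x - Q \<epsilon> x) / \<epsilon> \<le> v * g - \<alpha> g" using \<epsilon> by (simp add: pos_divide_le_eq)
    qed
  next
    case False
    have "M \<le> \<alpha> h\<^sub>0 / h\<^sub>0" using h0 by (simp add: pos_le_divide_eq)
    also have "\<dots> \<le> \<alpha> g / g" using False h0 by (intro ratio_mono) auto
    finally have "M \<le> \<alpha> g / g" .
    then have "M * g \<le> \<alpha> g" using False h0 by (simp add: pos_le_divide_eq)
    have "f x - f y \<le> M * (\<epsilon> * g)" using lip[of x y] g by simp
    then have "f x - Q \<epsilon> x \<le> \<epsilon> * (M * g - \<alpha> g)" by (simp add: eq algebra_simps)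
    also have "\<dots> \<le> 0" using \<open>M * g \<le> \<alpha> g\<close> \<epsilon> by (simp add: mult_le_0_iff)
    finally have "(f x - Q \<epsilon> x) / \<epsilon> \<le> 0" using \<epsilon> by (simp add: divide_le_0_iff)
    then show ?thesis using h0(1) by (intro that[of 0]) (auto simp: zero)
  qed
qed

text \<open>Relevant displacements are at most \<open>s n * h\<^sub>0\<close>, so eventually only
  the descent near \<open>x\<close> counts, at a rate of at most \<open>u + e'\<close>. What
  remains, gain minus cost at \<open>h\<close>, is one of the values in the supremum defining the
  conjugate.\<close>

lemma limsup_decrement_le:
  assumes lip: "\<And>x y. f x - f y \<le> M * dist x y" and M: "M \<ge> 0"
    and h0: "h\<^sub>0 > 0" "M * h\<^sub>0 \<le> \<alpha> h\<^sub>0"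
    and s: "s \<longlonglongrightarrow> 0" "\<And>n. s n > 0"
  shows "limsup (\<lambda>n. ennreal ((f x - Q (s n) x) / s n * exp (f x)))
    \<le> conjugate \<alpha> (descending_slope f x) * ennreal (exp (f x))"
proof -
  let ?S = "descending_slope f x"
  have "?S \<le> ennreal M" unfolding descending_slope_def
  proof (rule Limsup_bounded)
    have "eventually (\<lambda>y. y \<noteq> x) (at x)" by (simp add: eventually_at_filter)
    then show "eventually (\<lambda>y. ennreal (max 0 (- (f y - f x)) / dist x y) \<le> ennreal M) (at x)"
    proof eventually_elim
      case (elim y)
      then show ?case using lip[of x y] M by (intro ennreal_leI) (simp add: pos_divide_le_eq)
    qed
  qed
  then obtain u where u: "u \<ge> 0" "?S = ennreal u"
    by (metis ennreal_cases ennreal_less_top less_top not_le top_unique)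
  have approx: "limsup (\<lambda>n. ennreal ((f x - Q (s n) x) / s n * exp (f x)))
      \<le> conjugate \<alpha> ?S * ennreal (exp (f x)) + ennreal e" if e: "e > 0" for e
  proof (rule Limsup_bounded)
    \<comment> \<open>The excess rate \<open>e'\<close> acts over a scaled distance of at most
      \<open>h\<^sub>0\<close> and is weighted by \<open>exp (f x)\<close>; the total excess is
      \<open>e\<close>.\<close>
    define e' where "e' = e / (h\<^sub>0 * exp (f x))"
    have e': "e' > 0" using e h0 by (simp add: e'_def)
    have e'_eq: "e' * h\<^sub>0 * exp (f x) = e" using h0 by (simp add: e'_def)
    have "?S < ennreal (u + e')" using u e' by (simp add: ennreal_lessI)
    then have "eventually (\<lambda>y. ennreal (max 0 (- (f y - f x)) / dist x y) < ennreal (u + e')) (at x)"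
      unfolding descending_slope_def by (rule Limsup_lessD)
    then obtain \<rho> where \<rho>: "\<rho> > 0" "\<And>y. y \<noteq> x \<Longrightarrow> dist y x < \<rho> \<Longrightarrow>
        ennreal (max 0 (- (f y - f x)) / dist x y) < ennreal (u + e')"
      unfolding eventually_at by blast
    have slope: "f x - f y \<le> (u + e') * dist x y" if "dist x y < \<rho>" for y
    proof (cases "y = x")
      case False
      then have "max 0 (- (f y - f x)) / dist x y < u + e'"
        using \<rho>(2)[OF False] that by (simp add: dist_commute ennreal_less_iff)
      then show ?thesis using False by (simp add: pos_divide_less_eq)
    qed simp
    have "(\<lambda>n. s n * h\<^sub>0) \<longlonglongrightarrow> 0 * h\<^sub>0" by (intro tendsto_intros s)
    then have "eventually (\<lambda>n. s n * h\<^sub>0 < \<rho>) sequentially"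
      by (rule order_tendstoD) (use \<rho> in simp)
    then show "eventually (\<lambda>n. ennreal ((f x - Q (s n) x) / s n * exp (f x))
        \<le> conjugate \<alpha> ?S * ennreal (exp (f x)) + ennreal e) sequentially"
    proof eventually_elim
      case (elim n)
      obtain h where h: "0 \<le> h" "h \<le> h\<^sub>0"
        "\<And>v. (\<And>y. dist x y \<le> s n * h\<^sub>0 \<Longrightarrow> f x - f y \<le> v * dist x y) \<Longrightarrow>
          (f x - Q (s n) x) / s n \<le> v * h - \<alpha> h"
        using decrement_bound[OF lip M h0 s(2)[of n]] by blast
      have "(f x - Q (s n) x) / s n \<le> (u + e') * h - \<alpha> h"
        using slope elim by (intro h(3)) auto
      also have "\<dots> \<le> (u * h - \<alpha> h) + e' * h\<^sub>0"
        using h e' by (simp add: algebra_simps)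
      also have "\<dots> \<le> max 0 (h * u - \<alpha> h) + e' * h\<^sub>0" by (simp add: mult.commute)
      finally have "(f x - Q (s n) x) / s n * exp (f x) \<le> (max 0 (h * u - \<alpha> h) + e' * h\<^sub>0) * exp (f x)"
        by (intro mult_right_mono) auto
      also have "\<dots> = max 0 (h * u - \<alpha> h) * exp (f x) + e" using e'_eq by (simp add: distrib_right)
      finally have "ennreal ((f x - Q (s n) x) / s n * exp (f x))
          \<le> ennreal (max 0 (h * u - \<alpha> h) * exp (f x) + e)" by (rule ennreal_leI)
      also have "\<dots> = ennreal (h * u - \<alpha> h) * ennreal (exp (f x)) + ennreal e"
        using e by (simp add: ennreal_mult Equivalence_Lebesgue_Henstock_Integration.ennreal_max_0)
      also have "ennreal (h * u - \<alpha> h) = ennreal h * ennreal u - ennreal (\<alpha> h)"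
        using h(1) u(1) nonneg[OF h(1)] by (simp add: ennreal_minus flip: ennreal_mult)
      also have "\<dots> \<le> conjugate \<alpha> ?S"
        unfolding conjugate_def u(2) using h(1) by (intro SUP_upper) simp
      finally show ?case by (simp add: add_right_mono mult_right_mono)
    qed
  qed
  show ?thesis by (rule ennreal_le_epsilon) (rule approx)
qed

text \<open>Differentiating the hypercontractive estimate at time \<open>0\<close>, with \<open>t = t\<^sub>0 = \<epsilon> \<rightarrow> 0\<close>.\<close>
lemma entropy_le_conjugate_slope:
  assumes lip: "\<And>x y. f x - f y \<le> M * dist x y" and M: "M \<ge> 0"
    and h0: "h\<^sub>0 > 0" "M * h\<^sub>0 \<le> \<alpha> h\<^sub>0"
    and C: "C > 0" and p: "p > 1"
    and hyper: "\<And>\<epsilon>. 0 < \<epsilon> \<Longrightarrow> \<epsilon> < C * (p - 1) \<Longrightarrow>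
      Lk_norm \<mu> 1 (\<lambda>x. exp (Q \<epsilon> x)) \<le> Lk_norm \<mu> (hyper_exponent C p \<epsilon> 0) (\<lambda>x. exp (f x))"
  shows "ennreal (Ent \<mu> (\<lambda>x. exp (f x)))
    \<le> ennreal C * (\<integral>\<^sup>+x. conjugate \<alpha> (descending_slope f x) * ennreal (exp (f x)) \<partial>\<mu>)"
proof -
  note [measurable] = measurable_initial
  define E where "E = Ent \<mu> (\<lambda>x. exp (f x))"
  define Z where "Z = (\<integral>x. exp (f x) \<partial>\<mu>)"
  define G where "G = (\<integral>x. f x * exp (f x) \<partial>\<mu>)"
  define \<kappa> where "\<kappa> \<epsilon> = hyper_exponent C p \<epsilon> 0" for \<epsilon>
  \<comment> \<open>The majorant from \<open>Lk_norm_near_one_le\<close>. As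
    \<open>\<kappa> 0 = 1\<close> with derivative \<open>- 1 / C\<close>, its derivative at 0 is
    \<open>- (G - Z * ln Z) / C\<close>; this is where the entropy comes from.\<close>
  define \<phi> where "\<phi> \<epsilon> = exp ((ln Z - (1 - \<kappa> \<epsilon>) * (G / Z) + (1 - \<kappa> \<epsilon>)\<^sup>2 * B\<^sup>2) / \<kappa> \<epsilon>)" for \<epsilon>
  have Z: "Z > 0" unfolding Z_def by (rule integral_exp_pos[OF measurable_initial bound])
  have E_eq: "E = G - Z * ln Z"
    unfolding E_def G_def Z_def by (rule Ent_exp[OF measurable_initial bound])
  have \<kappa>0: "\<kappa> 0 = 1" by (simp add: \<kappa>_def)
  have d\<kappa>: "(\<kappa> has_real_derivative - inverse C) (at 0)"
  proof -
    have "((\<lambda>\<epsilon>. 1 + inverse C * (0 - \<epsilon>) / (p - 1)) has_real_derivative - inverse C / (p - 1)) (at 0)"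
      using p by (auto intro!: derivative_eq_intros)
    from DERIV_fun_powr[OF this, of "p - 1"] show ?thesis
      unfolding \<kappa>_def[abs_def] hyper_exponent_def using p by simp
  qed
  have d\<phi>: "(\<phi> has_real_derivative - (E / C)) (at 0)"
    unfolding \<phi>_def[abs_def]
    by (rule derivative_eq_intros d\<kappa> refl | simp add: \<kappa>0)+
      (use Z C in \<open>simp add: E_eq \<kappa>0 field_simps\<close>)
  have \<phi>0: "\<phi> 0 = Z" using Z by (simp add: \<phi>_def \<kappa>0)
  have "(\<kappa> \<longlongrightarrow> 1) (at 0)" using DERIV_isCont[OF d\<kappa>] by (simp add: isCont_def \<kappa>0)
  then have "(\<kappa> \<longlongrightarrow> 1) (at_right 0)" by (rule tendsto_within_subset) simp
  then have "((\<lambda>\<epsilon>. (1 - \<kappa> \<epsilon>) * B) \<longlongrightarrow> (1 - 1) * B) (at_right 0)" by (intro tendsto_intros)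
  then have ev1: "eventually (\<lambda>\<epsilon>. (1 - \<kappa> \<epsilon>) * B < 1) (at_right 0)" by (rule order_tendstoD) simp
  have pC: "0 < C * (p - 1)" using p C by simp
  have ev2: "eventually (\<lambda>\<epsilon>. 0 < \<epsilon> \<and> \<epsilon> < C * (p - 1)) (at_right 0)"
    by (auto simp: eventually_at_right[OF pC] intro: exI[of _ "C * (p - 1)"] pC)
  have "eventually (\<lambda>\<epsilon>. 0 < \<epsilon> \<and> \<epsilon> < C * (p - 1) \<and> (1 - \<kappa> \<epsilon>) * B < 1) (at_right 0)"
    using ev1 ev2 by eventually_elim simp
  then obtain \<rho> where \<rho>: "\<rho> > 0" "\<And>\<epsilon>. 0 < \<epsilon> \<Longrightarrow> \<epsilon> < \<rho> \<Longrightarrow> \<epsilon> < C * (p - 1) \<and> (1 - \<kappa> \<epsilon>) * B < 1"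
    by (auto simp: eventually_at_right[OF zero_less_one])
  \<comment> \<open>Starting with the factor 1/2 keeps every term strictly below
    \<open>\<rho>\<close>.\<close>
  define s where "s n = \<rho> * inverse (real (Suc (Suc n)))" for n
  have s_pos: "s n > 0" for n using \<rho> by (simp add: s_def)
  have s_lt: "s n < \<rho>" for n using \<rho>(1) by (simp add: s_def field_simps add_pos_nonneg)
  have s_lim: "s \<longlonglongrightarrow> 0"
  proof -
    have "(\<lambda>n. \<rho> * inverse (real (Suc (Suc n)))) \<longlonglongrightarrow> \<rho> * 0"
      by (intro tendsto_intros LIMSEQ_Suc[OF LIMSEQ_inverse_real_of_nat])
    then show ?thesis by (simp add: s_def[abs_def])
  qed
  define w where "w n x = (f x - Q (s n) x) / s n" for n x
  have [measurable]: "w n \<in> borel_measurable \<mu>" for n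
    using measurable_flow[OF s_pos] unfolding w_def by measurable
  have w_nonneg: "w n x \<ge> 0" for n x using flow_le_self[OF s_pos] s_pos[of n] by (simp add: w_def)
  have w_le: "w n x \<le> M * h\<^sub>0" for n x
  proof -
    obtain h where h: "0 \<le> h" "h \<le> h\<^sub>0"
      "\<And>v. (\<And>y. dist x y \<le> s n * h\<^sub>0 \<Longrightarrow> f x - f y \<le> v * dist x y) \<Longrightarrow> (f x - Q (s n) x) / s n \<le> v * h - \<alpha> h"
      using decrement_bound[OF lip M h0 s_pos[of n]] by blast
    have "w n x \<le> M * h - \<alpha> h" unfolding w_def by (rule h(3)) (rule lip)
    also have "\<dots> \<le> M * h\<^sub>0" using mult_left_mono[OF h(2) M] nonneg[OF h(1)] by linarith
    finally show ?thesis .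
  qed
  have int: "integrable \<mu> (\<lambda>x. w n x * exp (f x))" for n
    by (rule integrable_mult_exp[OF measurable_initial _ bound]) (use w_nonneg w_le in auto)
  have low: "(Z - \<phi> (s n)) / s n \<le> (\<integral>x. w n x * exp (f x) \<partial>\<mu>)" for n
  proof -
    note meas [measurable] = measurable_flow[OF s_pos[of n]]
    have sC: "s n < C * (p - 1)" "(1 - \<kappa> (s n)) * B < 1" using \<rho>(2)[OF s_pos s_lt] by auto
    have base: "0 < 1 + inverse C * (0 - s n) / (p - 1)" using sC(1) C p by (simp add: field_simps)
    have \<kappa>_pos: "\<kappa> (s n) > 0"
      unfolding \<kappa>_def hyper_exponent_def powr_gt_zero using base by (rule less_imp_neq[symmetric])
    have \<kappa>_le: "\<kappa> (s n) \<le> 1" unfolding \<kappa>_def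
      using sC(1) s_pos[of n] by (intro hyper_exponent_le_one C p) auto
    have "(\<integral>x. exp (Q (s n) x) \<partial>\<mu>) = Lk_norm \<mu> 1 (\<lambda>x. exp (Q (s n) x))"
      using integral_exp_pos[OF meas flow_bound[OF s_pos]] by (simp add: Lk_norm_def)
    also have "\<dots> \<le> Lk_norm \<mu> (\<kappa> (s n)) (\<lambda>x. exp (f x))"
      unfolding \<kappa>_def by (rule hyper[OF s_pos sC(1)])
    also have "\<dots> \<le> \<phi> (s n)" unfolding \<phi>_def Z_def G_def
      using sC(2) by (intro Lk_norm_near_one_le[OF measurable_initial bound \<kappa>_pos \<kappa>_le]) simp
    finally have "Z - \<phi> (s n) \<le> Z - (\<integral>x. exp (Q (s n) x) \<partial>\<mu>)" by simp
    also have "\<dots> = (\<integral>x. exp (f x) - exp (Q (s n) x) \<partial>\<mu>)"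
      unfolding Z_def
      using integrable_exp[OF measurable_initial bound] integrable_exp[OF meas flow_bound[OF s_pos]]
      by simp
    also have "\<dots> \<le> (\<integral>x. s n * (w n x * exp (f x)) \<partial>\<mu>)"
    proof (rule integral_mono)
      fix x
      have "1 + (Q (s n) x - f x) \<le> exp (Q (s n) x - f x)" by (rule exp_ge_add_one_self)
      then have "(1 + (Q (s n) x - f x)) * exp (f x) \<le> exp (Q (s n) x - f x) * exp (f x)"
        by (rule mult_right_mono) simp
      moreover have sw: "s n * (w n x * exp (f x)) = (f x - Q (s n) x) * exp (f x)"
        using s_pos[of n] by (simp add: w_def)
      moreover have "exp (Q (s n) x - f x) * exp (f x) = exp (Q (s n) x)" by (simp flip: exp_add)
      ultimately show "exp (f x) - exp (Q (s n) x) \<le> s n * (w n x * exp (f x))"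
        using sw by (simp add: algebra_simps)
    qed (use int integrable_exp[OF measurable_initial bound] integrable_exp[OF meas flow_bound[OF s_pos]] in auto)
    also have "\<dots> = s n * (\<integral>x. w n x * exp (f x) \<partial>\<mu>)" using int by simp
    finally show ?thesis using s_pos[of n] by (simp add: divide_le_eq mult.commute)
  qed
  have "(\<lambda>n. (\<phi> (0 + s n) - \<phi> 0) / s n) \<longlonglongrightarrow> - (E / C)"
  proof (rule filterlim_compose[OF d\<phi>[unfolded DERIV_def]])
    show "filterlim s (at 0) sequentially"
      using s_lim s_pos by (auto simp: filterlim_at less_imp_neq[symmetric])
  qed
  then have "(\<lambda>n. - ((\<phi> (0 + s n) - \<phi> 0) / s n)) \<longlonglongrightarrow> - (- (E / C))" by (rule tendsto_minus)
  then have "(\<lambda>n. (Z - \<phi> (s n)) / s n) \<longlonglongrightarrow> E / C"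
    by (simp only: \<phi>0 minus_divide_left minus_diff_eq add_0 minus_minus)
  then have "ennreal (E / C) = limsup (\<lambda>n. ennreal ((Z - \<phi> (s n)) / s n))"
    by (intro lim_imp_Limsup[symmetric] tendsto_ennrealI) auto
  also have "\<dots> \<le> limsup (\<lambda>n. \<integral>\<^sup>+x. ennreal (w n x * exp (f x)) \<partial>\<mu>)"
  proof (intro Limsup_mono always_eventually allI)
    fix n
    have "(\<integral>\<^sup>+x. ennreal (w n x * exp (f x)) \<partial>\<mu>) = ennreal (\<integral>x. w n x * exp (f x) \<partial>\<mu>)"
      using int[of n] w_nonneg by (intro nn_integral_eq_integral) auto
    then show "ennreal ((Z - \<phi> (s n)) / s n) \<le> (\<integral>\<^sup>+x. ennreal (w n x * exp (f x)) \<partial>\<mu>)"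
      using low[of n] by (simp add: ennreal_leI)
  qed
  \<comment> \<open>The reverse Fatou lemma needs an integrable dominating function. It comes from
    \<open>w_le\<close>, hence from the assumption
    \<open>M * h\<^sub>0 \<le> \<alpha> h\<^sub>0\<close>.\<close>
  also have "\<dots> \<le> (\<integral>\<^sup>+x. limsup (\<lambda>n. ennreal (w n x * exp (f x))) \<partial>\<mu>)"
  proof (rule nn_integral_limsup[where w = "\<lambda>_. ennreal (M * h\<^sub>0 * exp B)"])
    fix n
    have "w n x * exp (f x) \<le> M * h\<^sub>0 * exp B" for x
      using w_le[of n x] w_nonneg[of n x] bound[of x] M h0 by (intro mult_mono) auto
    then show "AE x in \<mu>. ennreal (w n x * exp (f x)) \<le> ennreal (M * h\<^sub>0 * exp B)"
      by (intro AE_I2 ennreal_leI)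
    show "(\<integral>\<^sup>+x. ennreal (M * h\<^sub>0 * exp B) \<partial>\<mu>) < \<infinity>" by (simp add: emeasure_space_1)
  qed simp_all
  also have "\<dots> \<le> (\<integral>\<^sup>+x. conjugate \<alpha> (descending_slope f x) * ennreal (exp (f x)) \<partial>\<mu>)"
    unfolding w_def by (intro nn_integral_mono limsup_decrement_le[OF lip M h0 s_lim s_pos])
  finally have "ennreal C * ennreal (E / C)
      \<le> ennreal C * (\<integral>\<^sup>+x. conjugate \<alpha> (descending_slope f x) * ennreal (exp (f x)) \<partial>\<mu>)"
    by (rule mult_left_mono) simp
  moreover have "ennreal C * ennreal (E / C) = ennreal E"
    using C by (simp add: ennreal_mult'[symmetric])
  ultimately show ?thesis by (simp add: E_def)
qed

end

lemma descending_slope_affine_le: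
  assumes "0 \<le> l" "l \<le> 1"
  shows "descending_slope (\<lambda>x. l * f x + c) x \<le> descending_slope f x"
  unfolding descending_slope_def
proof (intro Limsup_mono always_eventually allI ennreal_leI divide_right_mono)
  fix y
  have "l * (f x - f y) \<le> max 0 (f x - f y)"
  proof (cases "f x - f y \<ge> 0")
    case True
    then have "l * (f x - f y) \<le> 1 * (f x - f y)" using assms by (intro mult_right_mono) auto
    then show ?thesis by simp
  qed (use assms in \<open>simp add: mult_le_0_iff max_def\<close>)
  then show "max 0 (- (l * f y + c - (l * f x + c))) \<le> max 0 (- (f y - f x))"
    by (simp add: algebra_simps)
qed simp

text \<open>Control at one scale \<open>r\<close> extends to all distances because \<open>f\<close>
  is bounded: pairs farther apart than \<open>r\<close> have quotient at most
  \<open>2 * B / r\<close>.\<close>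

lemma F_class_lipschitz:
  fixes f :: "'a::metric_space \<Rightarrow> real"
  assumes "f \<in> F_class \<alpha>"
  obtains B M where "\<And>x. \<bar>f x\<bar> \<le> B" "M \<ge> 0" "\<And>x y. \<bar>f x - f y\<bar> \<le> M * dist x y"
    "ennreal M \<le> Lim at_top (\<lambda>h. ennreal (\<alpha> h / h))"
proof -
  have "bounded (range f)" using assms by (simp add: F_class_def)
  then obtain B where B: "\<And>x. \<bar>f x\<bar> \<le> B" by (auto simp: bounded_iff)
  obtain r where r: "r > 0" "Lip_upto f r < \<infinity>" using assms by (auto simp: F_class_def)
  then obtain m where m: "m \<ge> 0" "Lip_upto f r = ennreal m" by (cases "Lip_upto f r") auto
  have quot: "ennreal (\<bar>f y - f x\<bar> / dist x y) \<le> ennreal (max m (2 * B / r))" if "x \<noteq> y" for x y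
  proof (cases "dist x y \<le> r")
    case True
    then have "ennreal (\<bar>f y - f x\<bar> / dist x y) \<le> Lip_upto f r"
      unfolding Lip_upto_def using that by (intro SUP_upper2[where i = "(x, y)"]) auto
    also have "\<dots> \<le> ennreal (max m (2 * B / r))" unfolding m(2) by (intro ennreal_leI) simp
    finally show ?thesis .
  next
    case False
    have "\<bar>f y - f x\<bar> \<le> 2 * B" using B[of x] B[of y] by linarith
    then have "\<bar>f y - f x\<bar> / dist x y \<le> 2 * B / r" using False r by (intro frac_le) auto
    then show ?thesis by (intro ennreal_leI) simp
  qed
  have "Lip f \<le> ennreal (max m (2 * B / r))"
    unfolding Lip_def Lip_upto_def by (intro SUP_least, clarify) (rule quot)
  then obtain M where M: "M \<ge> 0" "Lip f = ennreal M"
    by (metis ennreal_cases ennreal_less_top less_top not_le top_unique)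
  have lip: "\<bar>f x - f y\<bar> \<le> M * dist x y" for x y
  proof (cases "x = y")
    case False
    have "ennreal (\<bar>f y - f x\<bar> / dist x y) \<le> Lip_upto f (dist x y)"
      unfolding Lip_upto_def using False by (intro SUP_upper2[where i = "(x, y)"]) auto
    also have "\<dots> \<le> Lip f" unfolding Lip_def using False by (intro SUP_upper) auto
    finally have "\<bar>f y - f x\<bar> / dist x y \<le> M" using M by simp
    then show ?thesis using False by (simp add: divide_le_eq abs_minus_commute)
  qed simp
  moreover have "ennreal M \<le> Lim at_top (\<lambda>h. ennreal (\<alpha> h / h))"
    using assms M by (simp add: F_class_def)
  ultimately show ?thesis using that B M(1) by blast
qed

context convex_cost
begin

text \<open>\<open>entropy_le_conjugate_slope\<close> is applied to contractions of \<open>f\<close>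
  whose energy never exceeds that of \<open>f\<close>; as they tend to \<open>f\<close>, only the
  entropy has to converge.\<close>

lemma LSI_of_hypercontractive:
  fixes \<mu> :: "'a::metric_space measure"
  assumes proper: "\<And>(x::'a) \<rho>. compact (cball x \<rho>)"
    and prob: "prob_space \<mu>" and borel: "sets \<mu> = sets borel"
    and C: "C > 0" and p: "p > 1"
    and hyper: "\<And>\<epsilon> f. 0 < \<epsilon> \<Longrightarrow> \<epsilon> < C * (p - 1) \<Longrightarrow> bounded (range f) \<Longrightarrow> continuous_on UNIV f \<Longrightarrow>
      Lk_norm \<mu> 1 (\<lambda>x. exp (hopf_lax \<alpha> \<epsilon> f x)) \<le> Lk_norm \<mu> (hyper_exponent C p \<epsilon> 0) (\<lambda>x. exp (f x))"
  shows "LSI_minus \<alpha> C \<mu>"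
  unfolding LSI_minus_def
proof
  interpret prob_space \<mu> by (rule prob)
  fix f :: "'a \<Rightarrow> real" assume "f \<in> F_class \<alpha>"
  then obtain B M where B: "\<And>x. \<bar>f x\<bar> \<le> B" and M: "M \<ge> 0" "\<And>x y. \<bar>f x - f y\<bar> \<le> M * dist x y"
    and M_le: "ennreal M \<le> Lim at_top (\<lambda>h. ennreal (\<alpha> h / h))"
    by (rule F_class_lipschitz) blast
  let ?rhs = "ennreal C * (\<integral>\<^sup>+x. conjugate \<alpha> (descending_slope f x) * ennreal (exp (f x)) \<partial>\<mu>)"
  have cont: "continuous_on UNIV f"
    by (rule continuous_on_subset[OF lipschitz_on_continuous_on[of M UNIV f]])
      (use M in \<open>auto intro!: lipschitz_onI simp: dist_real_def\<close>)
  have f_meas: "f \<in> borel_measurable \<mu>"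
    using borel_measurable_continuous_onI[OF cont] measurable_cong_sets[OF borel refl] by blast
  \<comment> \<open>If \<open>f\<close> has the extremal Lipschitz constant, the difference quotients of its Hopf-Lax
    semigroup need not be dominated; contracting \<open>f\<close> restores this, and the shift keeps the
    contracted function below \<open>f\<close>.\<close>
  define g where "g l x = l * f x - (1 - l) * B" for l x
  have g_bound: "\<bar>g l x\<bar> \<le> B" if l: "0 < l" "l < 1" for l x
  proof -
    have "\<bar>l * f x\<bar> \<le> l * B" using l B[of x] by (simp add: abs_mult)
    moreover have "B \<ge> 0" using B[of x] by linarith
    then have "0 \<le> (1 - l) * B" using l by simp
    ultimately show ?thesis unfolding g_def by (simp add: algebra_simps abs_le_iff)
  qed
  have step: "ennreal (Ent \<mu> (\<lambda>x. exp (g l x))) \<le> ?rhs" if l: "0 < l" "l < 1" for l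
  proof -
    have g_cont: "continuous_on UNIV (g l)" unfolding g_def by (intro continuous_intros cont)
    interpret F: hopf_lax_measure \<alpha> \<alpha>' "g l" B \<mu>
      by unfold_locales (fact proper g_cont g_bound[OF l] borel)+
    \<comment> \<open>\<open>M\<close> is at most the supremum of \<open>\<alpha> h / h\<close>, so
      the strictly smaller \<open>l * M\<close> is exceeded by some quotient. For
      \<open>M = 0\<close> there is no strictness, and \<open>h = 1\<close> will do.\<close>
    have "\<exists>h>0. l * M * h \<le> \<alpha> h"
    proof (cases "M = 0")
      case True then show ?thesis using nonneg[of 1] by (intro exI[of _ 1]) auto
    next
      case False
      then have "ennreal (l * M) < ennreal M" using l M by (intro ennreal_lessI) auto
      also have "\<dots> \<le> (SUP h\<in>{0<..}. ennreal (\<alpha> h / h))" using M_le by (simp add: Lim_ratio_eq)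
      finally obtain h where "h > 0" "ennreal (l * M) < ennreal (\<alpha> h / h)" by (auto simp: less_SUP_iff)
      moreover have "l * M \<ge> 0" using l M by simp
      ultimately have "l * M < \<alpha> h / h" by (simp add: ennreal_less_iff)
      then show ?thesis using \<open>h > 0\<close> by (auto simp: pos_less_divide_eq intro!: exI[of _ h])
    qed
    then obtain h where h: "h > 0" "l * M * h \<le> \<alpha> h" by blast
    have "ennreal (Ent \<mu> (\<lambda>x. exp (g l x)))
        \<le> ennreal C * (\<integral>\<^sup>+x. conjugate \<alpha> (descending_slope (g l) x) * ennreal (exp (g l x)) \<partial>\<mu>)"
    proof (rule F.entropy_le_conjugate_slope[OF _ _ h C p])
      fix x y
      have "l * (f x - f y) \<le> l * (M * dist x y)" using M(2)[of x y] l by (intro mult_left_mono) auto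
      then show "g l x - g l y \<le> l * M * dist x y" by (simp add: g_def algebra_simps)
    next
      have "bounded (range (g l))" using g_bound[OF l] by (auto simp: bounded_iff)
      then show "Lk_norm \<mu> 1 (\<lambda>x. exp (hopf_lax \<alpha> \<epsilon> (g l) x))
          \<le> Lk_norm \<mu> (hyper_exponent C p \<epsilon> 0) (\<lambda>x. exp (g l x))"
        if "0 < \<epsilon>" "\<epsilon> < C * (p - 1)" for \<epsilon>
        using hyper that g_cont by blast
    qed (use l M in simp)
    also have "\<dots> \<le> ?rhs"
    proof (intro mult_left_mono nn_integral_mono mult_mono conjugate_mono ennreal_leI)
      fix x
      show "descending_slope (g l) x \<le> descending_slope f x"
        using descending_slope_affine_le[of l f "- ((1 - l) * B)" x] l by (simp add: g_def[abs_def])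
      have "(1 - l) * (- B) \<le> (1 - l) * f x" using B[of x] l by (intro mult_left_mono) auto
      then show "exp (g l x) \<le> exp (f x)" by (simp add: g_def algebra_simps)
    qed simp_all
    finally show ?thesis .
  qed
  \<comment> \<open>The values start at 1/2, so that every \<open>l n\<close> lies strictly between
    0 and 1.\<close>
  define l where "l n = 1 - inverse (real (Suc (Suc n)))" for n
  have l: "0 < l n" "l n < 1" for n by (auto simp: l_def field_simps)
  have "(\<lambda>n. 1 - inverse (real (Suc (Suc n)))) \<longlonglongrightarrow> 1 - 0"
    by (intro tendsto_intros LIMSEQ_Suc[OF LIMSEQ_inverse_real_of_nat])
  then have l_lim: "l \<longlonglongrightarrow> 1" by (simp add: l_def[abs_def])
  have g_lim: "(\<lambda>n. g (l n) x) \<longlonglongrightarrow> f x" for x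
  proof -
    have "(\<lambda>n. l n * f x - (1 - l n) * B) \<longlonglongrightarrow> 1 * f x - (1 - 1) * B"
      by (intro tendsto_intros l_lim)
    then show ?thesis by (simp add: g_def)
  qed
  have g_meas [measurable]: "g l \<in> borel_measurable \<mu>" for l unfolding g_def using f_meas by measurable
  note [measurable] = f_meas
  have lim_Z: "(\<lambda>n. \<integral>x. exp (g (l n) x) \<partial>\<mu>) \<longlonglongrightarrow> (\<integral>x. exp (f x) \<partial>\<mu>)"
  proof (rule integral_dominated_convergence[where w = "\<lambda>_. exp B"])
    show "AE x in \<mu>. (\<lambda>n. exp (g (l n) x)) \<longlonglongrightarrow> exp (f x)" by (intro AE_I2 tendsto_intros g_lim)
    show "AE x in \<mu>. norm (exp (g (l n) x)) \<le> exp B" for n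
      using g_bound[OF l] by (intro AE_I2) (auto dest: abs_le_D1)
  qed auto
  have lim_G: "(\<lambda>n. \<integral>x. g (l n) x * exp (g (l n) x) \<partial>\<mu>) \<longlonglongrightarrow> (\<integral>x. f x * exp (f x) \<partial>\<mu>)"
  proof (rule integral_dominated_convergence[where w = "\<lambda>_. B * exp B"])
    show "AE x in \<mu>. (\<lambda>n. g (l n) x * exp (g (l n) x)) \<longlonglongrightarrow> f x * exp (f x)"
      by (intro AE_I2 tendsto_intros g_lim)
    have "\<bar>g (l n) x\<bar> * exp (g (l n) x) \<le> B * exp B" for n x
      using g_bound[OF l, of n x] by (intro mult_mono) auto
    then show "AE x in \<mu>. norm (g (l n) x * exp (g (l n) x)) \<le> B * exp B" for n
      by (intro AE_I2) (simp add: abs_mult)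
  qed auto
  have "(\<integral>x. exp (f x) \<partial>\<mu>) > 0" by (rule integral_exp_pos[OF f_meas B])
  then have "(\<lambda>n. (\<integral>x. g (l n) x * exp (g (l n) x) \<partial>\<mu>) - (\<integral>x. exp (g (l n) x) \<partial>\<mu>) * ln (\<integral>x. exp (g (l n) x) \<partial>\<mu>))
      \<longlonglongrightarrow> (\<integral>x. f x * exp (f x) \<partial>\<mu>) - (\<integral>x. exp (f x) \<partial>\<mu>) * ln (\<integral>x. exp (f x) \<partial>\<mu>)"
    by (intro tendsto_intros lim_Z lim_G) simp
  then have "(\<lambda>n. Ent \<mu> (\<lambda>x. exp (g (l n) x))) \<longlonglongrightarrow> Ent \<mu> (\<lambda>x. exp (f x))"
    by (simp only: Ent_exp[OF g_meas g_bound[OF l]] Ent_exp[OF f_meas B])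
  then have "(\<lambda>n. ennreal (Ent \<mu> (\<lambda>x. exp (g (l n) x)))) \<longlonglongrightarrow> ennreal (Ent \<mu> (\<lambda>x. exp (f x)))"
    by (rule tendsto_ennrealI)
  then show "ennreal (Ent \<mu> (\<lambda>x. exp (f x))) \<le> ?rhs"
    by (rule LIMSEQ_le_const2) (use step[OF l] in blast)
qed

text \<open>The tangent at \<open>x\<close>, read off at 0, bounds the quotients below by 1; read
  off at \<open>2 * x\<close> and combined with doubling, it bounds them above by
  \<open>K\<close>.\<close>

lemma exponents:
  assumes Delta2: "\<exists>K>0. \<forall>x\<ge>0. \<alpha> (2 * x) \<le> K * \<alpha> x"
  obtains r p where "lower_exponent \<alpha> \<alpha>' = ereal r" "upper_exponent \<alpha> \<alpha>' = ereal p" "1 \<le> r" "r \<le> p"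
    "\<And>x. x > 0 \<Longrightarrow> r * \<alpha> x \<le> x * \<alpha>' x" "\<And>x. x > 0 \<Longrightarrow> x * \<alpha>' x \<le> p * \<alpha> x"
proof -
  let ?q = "\<lambda>x. x * \<alpha>' x / \<alpha> x"
  obtain K where K: "K > 0" "\<And>x. x \<ge> 0 \<Longrightarrow> \<alpha> (2 * x) \<le> K * \<alpha> x" using Delta2 by blast
  have ge1: "1 \<le> ?q x" if "x > 0" for x
    using tangent_le[of x 0] pos[OF that] that zero by (simp add: pos_le_divide_eq algebra_simps)
  have leK: "?q x \<le> K" if "x > 0" for x
  proof -
    have "\<alpha> x + \<alpha>' x * (2 * x - x) \<le> \<alpha> (2 * x)" using that by (intro tangent_le) auto
    then have "x * \<alpha>' x \<le> K * \<alpha> x" using K(2)[of x] pos[OF that] that by (simp add: algebra_simps)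
    then show ?thesis using pos[OF that] by (simp add: pos_divide_le_eq)
  qed
  define S where "S = ?q ` {0<..}"
  have S: "S \<noteq> {}" "bdd_below S" "bdd_above S"
    using ge1 leK by (auto simp: S_def intro!: bdd_belowI[of _ 1] bdd_aboveI[of _ K])
  have lower: "lower_exponent \<alpha> \<alpha>' = ereal (Inf S)"
    using ereal_Inf'[OF S(2,1)] by (simp add: lower_exponent_def S_def image_image)
  have upper: "upper_exponent \<alpha> \<alpha>' = ereal (Sup S)"
    using ereal_Sup[OF ereal_SUP_not_infty[of S "ereal 1" "ereal K"]] S(1) ge1 leK
    by (simp add: upper_exponent_def S_def image_image)
  show ?thesis
  proof (rule that[OF lower upper])
    show "1 \<le> Inf S" using ge1 S(1) by (intro cInf_greatest) (auto simp: S_def)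
    show "Inf S \<le> Sup S" using S by (intro cInf_le_cSup)
    fix x :: real assume x: "x > 0"
    then have "?q x \<in> S" by (simp add: S_def)
    then have "Inf S \<le> ?q x" "?q x \<le> Sup S" using S by (auto intro: cInf_lower cSup_upper)
    then show "Inf S * \<alpha> x \<le> x * \<alpha>' x" "x * \<alpha>' x \<le> Sup S * \<alpha> x"
      using pos[OF x] by (simp_all add: pos_le_divide_eq pos_divide_le_eq)
  qed
qed

text \<open>Both growth bounds hold with \<open>P = 1\<close>, so \<open>cost_scale_ge\<close>
  applies to every factor; scaling from 1 to \<open>x\<close> and back gives equality.\<close>

lemma linear_if_exponent_one:
  assumes "\<And>x. x > 0 \<Longrightarrow> x * \<alpha>' x = \<alpha> x"
  shows "\<exists>c. \<forall>x\<ge>0. \<alpha> x = c * x"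
proof (intro exI allI impI)
  fix x :: real assume "x \<ge> 0"
  show "\<alpha> x = \<alpha> 1 * x"
  proof (cases "x = 0")
    case False
    then have x: "x > 0" using \<open>x \<ge> 0\<close> by simp
    have "x powr 1 * \<alpha> 1 \<le> \<alpha> (x * 1)"
      using x assms by (intro cost_scale_ge) (cases "x \<le> 1"; auto)+
    moreover have "inverse x powr 1 * \<alpha> x \<le> \<alpha> (inverse x * x)"
      using x assms by (intro cost_scale_ge) (cases "inverse x \<le> 1"; auto)+
    ultimately show ?thesis using x by (simp add: field_simps)
  qed (simp add: zero)
qed

end

theorem theorem1p11:
  fixes \<mu> :: "'a::polish_space measure"
    and C :: real
    and \<alpha> \<alpha>' :: "real \<Rightarrow> real"
  assumes proper: "\<And>(x::'a) \<rho>. compact (cball x \<rho>)"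
    and prob: "prob_space \<mu>"
    and borel: "sets \<mu> = sets borel"
    and C_pos: "C > 0"
    and nonneg: "\<And>x. x \<ge> 0 \<Longrightarrow> \<alpha> x \<ge> 0"
    and incr: "strict_mono_on {0..} \<alpha>"
    and conv: "convex_on {0..} \<alpha>"
    and deriv: "\<And>x. x \<ge> 0 \<Longrightarrow> (\<alpha> has_real_derivative \<alpha>' x) (at x within {0..})"
    and C1: "continuous_on {0..} \<alpha>'"
    and zero: "\<alpha> 0 = 0"
    and Delta2: "\<exists>K>0. \<forall>x\<ge>0. \<alpha> (2 * x) \<le> K * \<alpha> x"
  shows "\<exists>r p :: real.
    lower_exponent \<alpha> \<alpha>' = ereal r \<and> upper_exponent \<alpha> \<alpha>' = ereal p \<and> 1 \<le> r \<and> r \<le> p \<and>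
    ((\<nexists>c. \<forall>x\<ge>0. \<alpha> x = c * x) \<longrightarrow>
      1 < p \<and>
      (LSI_minus \<alpha> C \<mu> \<longleftrightarrow>
        (\<forall>t>0. \<forall>t\<^sub>0 \<le> C * (p - 1). \<forall>f :: 'a \<Rightarrow> real.
           bounded (range f) \<and> continuous_on UNIV f \<longrightarrow>
             Lk_norm \<mu> (k_exponent C r p t\<^sub>0 t) (\<lambda>x. exp (hopf_lax \<alpha> t f x))
               \<le> Lk_norm \<mu> (k_exponent C r p t\<^sub>0 0) (\<lambda>x. exp (f x)))))"
proof -
  interpret convex_cost \<alpha> \<alpha>'
    by unfold_locales (fact nonneg incr conv deriv C1 zero)+
  interpret prob_space \<mu> by (rule prob)
  obtain r p where lower: "lower_exponent \<alpha> \<alpha>' = ereal r" and upper: "upper_exponent \<alpha> \<alpha>' = ereal p"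
    and rp: "1 \<le> r" "r \<le> p"
    and growth: "\<And>x. x > 0 \<Longrightarrow> r * \<alpha> x \<le> x * \<alpha>' x" "\<And>x. x > 0 \<Longrightarrow> x * \<alpha>' x \<le> p * \<alpha> x"
    using exponents[OF Delta2] by blast
  \<comment> \<open>As \<open>1 \<le> r \<le> p\<close>, a failure forces both exponents to be 1 and
    turns the growth bounds into an equality. Linear costs are therefore the only exception.\<close>
  have "1 < p" if "\<nexists>c. \<forall>x\<ge>0. \<alpha> x = c * x"
  proof (rule ccontr)
    assume "\<not> 1 < p"
    then have "r = 1" "p = 1" using rp by auto
    then have "x * \<alpha>' x = \<alpha> x" if "x > 0" for x using growth[OF that] by simp
    then show False using linear_if_exponent_one that by blast
  qed
  moreover have "LSI_minus \<alpha> C \<mu> \<longleftrightarrow>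
        (\<forall>t>0. \<forall>t\<^sub>0 \<le> C * (p - 1). \<forall>f :: 'a \<Rightarrow> real.
           bounded (range f) \<and> continuous_on UNIV f \<longrightarrow>
             Lk_norm \<mu> (k_exponent C r p t\<^sub>0 t) (\<lambda>x. exp (hopf_lax \<alpha> t f x))
               \<le> Lk_norm \<mu> (k_exponent C r p t\<^sub>0 0) (\<lambda>x. exp (f x)))" (is "_ \<longleftrightarrow> ?hyper")
    if p: "1 < p"
  proof
    assume LSI: "LSI_minus \<alpha> C \<mu>"
    show ?hyper
    proof (intro allI impI, elim conjE)
      fix t t\<^sub>0 :: real and f :: "'a \<Rightarrow> real"
      assume t: "t > 0" "t\<^sub>0 \<le> C * (p - 1)" and f: "bounded (range f)" "continuous_on UNIV f"
      obtain B where B: "\<And>x. \<bar>f x\<bar> \<le> B" using f(1) by (auto simp: bounded_iff)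
      interpret hopf_lax_measure \<alpha> \<alpha>' f B \<mu>
        by unfold_locales (fact proper f(2) B borel)+
      show "Lk_norm \<mu> (k_exponent C r p t\<^sub>0 t) (\<lambda>x. exp (hopf_lax \<alpha> t f x))
          \<le> Lk_norm \<mu> (k_exponent C r p t\<^sub>0 0) (\<lambda>x. exp (f x))"
        by (rule hypercontractive[OF LSI C_pos p growth(2,1) t])
    qed
  next
    assume hyper: ?hyper
    show "LSI_minus \<alpha> C \<mu>"
    proof (rule LSI_of_hypercontractive[OF proper prob borel C_pos p])
      fix \<epsilon> and f :: "'a \<Rightarrow> real"
      assume \<epsilon>: "0 < \<epsilon>" "\<epsilon> < C * (p - 1)" and f: "bounded (range f)" "continuous_on UNIV f"
      \<comment> \<open>At both times the branch of \<open>p\<close> is in force; if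
        \<open>r > 1\<close> fails, the minimum with 1 changes nothing because that branch is at
        most 1 up to \<open>\<epsilon>\<close>.\<close>
      have "k_exponent C r p \<epsilon> \<epsilon> = 1" by (simp add: k_exponent_def)
      moreover have "k_exponent C r p \<epsilon> 0 = hyper_exponent C p \<epsilon> 0"
        using hyper_exponent_le_one[OF C_pos p, of 0 \<epsilon>] \<epsilon>
        by (simp add: k_exponent_def hyper_exponent_def)
      ultimately show "Lk_norm \<mu> 1 (\<lambda>x. exp (hopf_lax \<alpha> \<epsilon> f x))
          \<le> Lk_norm \<mu> (hyper_exponent C p \<epsilon> 0) (\<lambda>x. exp (f x))"
        using hyper \<epsilon> f by (metis less_imp_le)
    qed
  qed
  ultimately show ?thesis using lower upper rp by blast
qed

end
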